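(* Let $\Omega\subseteq\mathbb{R}^3$ be an open, bounded, simply connected polyhedral region and let $\mathcal{T}$ be a tetrahedral mesh of $\Omega$. Then $\mathcal{T}$ is bipartite if and only if for every interior edge $\sigma$ of $\mathcal{T}$ the number of incident tetrahedra $\#\{K\in\mathcal{T}:\sigma\subseteq\partial K\}$ is even.
   Context: A tetrahedral mesh $\mathcal{T}$ of a bounded open polyhedral domain $\mathcal{O}\subseteq\mathbb{R}^3$ (as usual, a domain equal to the interior of its closure, so no slits) is a finite conforming family of closed non-degenerate tetrahedra: their union is the closure of $\mathcal{O}$, and any two distinct tetrahedra meet in the empty set, a common vertex, a common edge, or a common face. The associated graph $\mathcal{G}_{\mathcal{T}}$ has the tetrahedra of $\mathcal{T}$ as vertices, with an arc between distinct $K,L\in\mathcal{T}$ if $|\partial K\cap\partial L|_2>0$ (area), i.e. if they share a common face. The mesh is called bipartite if $\mathcal{G}_{\mathcal{T}}$ is a bipartite graph. An edge of the mesh is exterior if it lies on $\partial\mathcal{O}$ and interior if it belongs to the interior of the domain; here an edge is understood without its endpoints (an interior edge may have endpoints on $\partial\mathcal{O}$). Simply connected means path connected with trivial fundamental group. *)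

theory Defs
  imports "HOL-Analysis.Analysis" "Graph_Theory.Pair_Digraph"
begin

text \<open>
  The equation \<open>interior (closure \<Omega>) = \<Omega>\<close> rules out slits. A finite union of polytopes need not be
  convex, nor need its boundary be a manifold.
\<close>
definition polyhedral_domain :: "(real^3) set \<Rightarrow> bool" where
  "polyhedral_domain \<Omega> \<longleftrightarrow>
     open \<Omega> \<and> bounded \<Omega> \<and> interior (closure \<Omega>) = \<Omega> \<and>
     (\<exists>\<P>. finite \<P> \<and> (\<forall>P\<in>\<P>. polytope P) \<and> \<Union>\<P> = closure \<Omega>)"

text \<open>
  Conformity is part of \<^const>\<open>triangulation\<close>: any two members meet in a common face, possibly
  empty. Distinct members are both three-dimensional here, so that face is proper, hence empty, a
  vertex, an edge or a triangle.
\<close>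
definition tetrahedral_mesh :: "(real^3) set set \<Rightarrow> (real^3) set \<Rightarrow> bool" where
  "tetrahedral_mesh \<T> \<Omega> \<longleftrightarrow>
     triangulation \<T> \<and> (\<forall>K\<in>\<T>. 3 simplex K) \<and> \<Union>\<T> = closure \<Omega>"

text \<open>
  In a conforming mesh \<open>frontier K \<inter> frontier L\<close> has positive area exactly when \<open>K\<close> and \<open>L\<close> share
  a triangular face. The undirected graph is represented by a symmetric set of ordered pairs.
\<close>
definition mesh_graph :: "(real^3) set set \<Rightarrow> (real^3) set pair_pre_digraph" where
  "mesh_graph \<T> =
     \<lparr> pverts = \<T>,
       parcs = {(K, L). K \<in> \<T> \<and> L \<in> \<T> \<and> K \<noteq> L \<and> (\<exists>F. F facet_of K \<and> F facet_of L)} \<rparr>"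

definition bipartite_graph :: "'a pair_pre_digraph \<Rightarrow> bool" where
  "bipartite_graph G \<longleftrightarrow>
     (\<exists>U V. pverts G = U \<union> V \<and> U \<inter> V = {} \<and> parcs G \<subseteq> U \<times> V \<union> V \<times> U)"

text \<open>
  Library edges are closed segments, so the relative interior removes the endpoints.
\<close>
definition mesh_edges :: "(real^3) set set \<Rightarrow> (real^3) set set" where
  "mesh_edges \<T> = {rel_interior e | e. \<exists>K\<in>\<T>. e edge_of K}"

definition interior_mesh_edges :: "(real^3) set set \<Rightarrow> (real^3) set \<Rightarrow> (real^3) set set" where
  "interior_mesh_edges \<T> \<Omega> = {\<sigma> \<in> mesh_edges \<T>. \<sigma> \<subseteq> interior \<Omega>}"

end

theory Submission
  imports Defs
begin

text \<open>
  The tetrahedra around a point \<open>x\<close> of \<open>\<Omega>\<close> are connected under adjacency, because a generic segment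
  near \<open>x\<close> crosses faces only. Hence a proper two-colouring of them is unique up to a swap, and the
  local two-colourings, once they exist, form a double cover of \<open>\<Omega>\<close>, which is trivial if \<open>\<Omega>\<close> is
  simply connected; a section is a two-colouring of the mesh. Around an interior edge the adjacency
  graph is connected and 2-regular, so it is bipartite exactly if the number of tetrahedra is even.
  At an interior vertex a local two-colouring comes from the same covering argument, applied to a
  small punctured ball around the vertex, which is simply connected in dimension three.
\<close>

section \<open>Double covers of simply connected sets\<close>

text \<open>Only vertices need the covering argument locally. A point inside a tetrahedron or a face
  lies in at most two tetrahedra, and a point inside an edge sees a cycle. At a vertex the argument
  is not circular, because a small punctured ball contains no vertex, so all its points are already
  settled. This is where dimension three enters: a punctured disc in the plane is not simply
  connected, and there the parity condition sits at the vertices themselves. The regularity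
  \<open>interior (closure \<Omega>) = \<Omega>\<close> puts the relative interior of every shared
  face inside \<Omega>, so no slit hides an adjacency from the colouring built over \<Omega>. The
  number of charts of the double cover depends on the mesh and cannot be part of a type; sequences
  offer a coordinate to each chart.\<close>

definition unit_bcontfun :: "nat \<Rightarrow> nat \<Rightarrow>\<^sub>C real"
  where "unit_bcontfun i = Bcontfun (\<lambda>j. if j = i then 1 else 0)"

lemma apply_unit_bcontfun: "apply_bcontfun (unit_bcontfun i) j = (if j = i then 1 else 0)"
proof -
  have "(\<lambda>j. if j = i then 1 else 0::real) \<in> bcontfun"
    by (auto simp: bcontfun_def bounded_iff image_def intro: exI[of _ 1])
  then show ?thesis
    by (simp add: unit_bcontfun_def Bcontfun_inverse)
qed

lemma apply_bcontfun_sum: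
  "apply_bcontfun (sum f A) x = (\<Sum>i\<in>A. apply_bcontfun (f i) x)"
  for f :: "'i \<Rightarrow> 'a::topological_space \<Rightarrow>\<^sub>C 'b::real_normed_vector"
  by (induction A rule: infinite_finite_induct) (auto simp: plus_bcontfun.rep_eq zero_bcontfun.rep_eq)

text \<open>Evaluation at a point is 1-Lipschitz for the supremum distance.\<close>

lemma continuous_on_apply_bcontfun_at:
  fixes f :: "'c::topological_space \<Rightarrow> 'a::topological_space \<Rightarrow>\<^sub>C 'b::metric_space"
  assumes "continuous_on A f"
  shows "continuous_on A (\<lambda>y. apply_bcontfun (f y) x)"
proof -
  have "isCont (\<lambda>h. apply_bcontfun h x) g" for g :: "'a \<Rightarrow>\<^sub>C 'b"
    unfolding continuous_at_eps_delta using dist_bounded le_less_trans by blast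
  then have "continuous_on UNIV (\<lambda>h :: 'a \<Rightarrow>\<^sub>C 'b. apply_bcontfun h x)"
    by (simp add: continuous_on_eq_continuous_at)
  from continuous_on_compose2[OF this assms] show ?thesis by simp
qed

text \<open>
  The hypothesis \<open>g\<close> says nothing outside \<open>U\<close>: there the zero of \<open>\<phi>\<close> forces continuity.
\<close>
lemma continuous_on_bump_mult:
  fixes \<phi> g :: "'a::metric_space \<Rightarrow> real"
  assumes cont: "continuous_on V \<phi>" and nz: "\<And>x. x \<in> V \<Longrightarrow> \<phi> x \<noteq> 0 \<longleftrightarrow> x \<in> U"
    and "open U" "open V"
    and g: "continuous_on (U \<inter> V) g" and bd: "\<And>x. x \<in> U \<inter> V \<Longrightarrow> \<bar>g x\<bar> \<le> 1"
  shows "continuous_on V (\<lambda>x. \<phi> x * g x)"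
proof (rule continuous_at_imp_continuous_on, rule ballI)
  fix x assume x: "x \<in> V"
  have c\<phi>: "isCont \<phi> x"
    using cont \<open>open V\<close> x continuous_on_eq_continuous_at by blast
  show "isCont (\<lambda>x. \<phi> x * g x) x"
  proof (cases "x \<in> U")
    case True
    then have "isCont g x"
      using g x \<open>open U\<close> \<open>open V\<close> continuous_on_eq_continuous_at[of "U \<inter> V" g] by blast
    with c\<phi> show ?thesis by (rule continuous_mult)
  next
    case False
    then have \<phi>0: "\<phi> x = 0" using nz x by auto
    have ev: "\<forall>\<^sub>F y in at x. norm (\<phi> y * g y) \<le> norm (\<phi> y) * 1"
    proof -
      have "\<forall>\<^sub>F y in at x. y \<in> V"
        using \<open>open V\<close> x by (simp add: eventually_at_in_open')
      then show ?thesis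
      proof eventually_elim
        case (elim y)
        show ?case
        proof (cases "y \<in> U")
          case True
          with bd elim have "\<bar>g y\<bar> \<le> 1" by blast
          then show ?thesis
            by (simp add: abs_mult mult_left_le)
        next
          case False
          with nz[OF elim] have "\<phi> y = 0" by simp
          then show ?thesis by simp
        qed
      qed
    qed
    have "(\<phi> \<longlongrightarrow> 0) (at x)" using c\<phi> \<phi>0 by (simp add: isCont_def)
    then have "((\<lambda>x. \<phi> x * g x) \<longlongrightarrow> 0) (at x)"
      using ev by (rule tendsto_0_le)
    then show ?thesis using \<phi>0 by (simp add: isCont_def)
  qed
qed

text \<open>
  The products \<open>\<sigma> i * \<sigma> j\<close> are the transition functions of a double cover of \<open>S\<close>. Lifting of maps is
  available for covers inside normed spaces only, so the cover is embedded in \<open>S \<times> (nat \<Rightarrow>\<^sub>C real)\<close>: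
  over \<open>x\<close> lie \<open>V x\<close> and \<open>- V x\<close>, where the coordinates of \<open>V x\<close> are the \<open>\<sigma> i x\<close>, damped by a bump
  function \<open>\<phi> i\<close> that vanishes outside \<open>U i\<close>.
\<close>
lemma sign_cocycle_trivial_nat:
  fixes S :: "'a::euclidean_space set" and U :: "nat \<Rightarrow> 'a set" and \<sigma> :: "nat \<Rightarrow> 'a \<Rightarrow> real"
  assumes sc: "simply_connected S" and "finite I"
    and opU: "\<And>i. i \<in> I \<Longrightarrow> open (U i)" and cov: "(\<Union>i\<in>I. U i) = S"
    and sg: "\<And>i x. i \<in> I \<Longrightarrow> x \<in> U i \<Longrightarrow> \<bar>\<sigma> i x\<bar> = 1"
    and co: "\<And>i j. i \<in> I \<Longrightarrow> j \<in> I \<Longrightarrow> continuous_on (U i \<inter> U j) (\<lambda>x. \<sigma> i x * \<sigma> j x)"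
  obtains s where "\<And>x. x \<in> S \<Longrightarrow> \<bar>s x\<bar> = 1"
    "\<And>i. i \<in> I \<Longrightarrow> continuous_on (U i) (\<lambda>x. s x * \<sigma> i x)"
proof -
  \<comment> \<open>The case \<open>UNIV\<close> is separate because \<open>infdist\<close> to the
    empty set is 0, which would make the bump vanish on all of \<open>U i\<close>.\<close>
  define \<phi> where "\<phi> i x = (if U i = UNIV then 1 else infdist x (- U i))" for i x
  have \<phi>c: "continuous_on A (\<phi> i)" for i A
    by (cases "U i = UNIV") (auto simp: \<phi>_def intro!: continuous_intros)
  have \<phi>nz: "\<phi> i x \<noteq> 0 \<longleftrightarrow> x \<in> U i" if "i \<in> I" for i x
    using in_closed_iff_infdist_zero[of "- U i" x] opU[OF that] by (auto simp: \<phi>_def closed_Compl)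
  have \<phi>ge: "\<phi> i x \<ge> 0" for i x
    by (simp add: \<phi>_def infdist_nonneg)
  define V where "V x = (\<Sum>i\<in>I. (\<phi> i x * \<sigma> i x) *\<^sub>R unit_bcontfun i)" for x
  have Vap: "apply_bcontfun (V x) j = \<phi> j x * \<sigma> j x" if "j \<in> I" for j x
  proof -
    have "apply_bcontfun (V x) j = (\<Sum>i\<in>I. if i = j then \<phi> j x * \<sigma> j x else 0)"
      unfolding V_def apply_bcontfun_sum
      by (rule sum.cong) (auto simp: scaleR_bcontfun.rep_eq apply_unit_bcontfun)
    also have "\<dots> = \<phi> j x * \<sigma> j x" using that \<open>finite I\<close> by simp
    finally show ?thesis .
  qed
  have sg2: "\<sigma> i x * \<sigma> i x = 1" if "i \<in> I" "x \<in> U i" for i x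
    using sg[OF that] by (metis abs_mult_self_eq mult_1)
  \<comment> \<open>Multiplied by \<open>\<sigma> j\<close>, the \<open>i\<close>-th coordinate
    becomes \<open>\<phi> i\<close> times the cocycle value, which is continuous on
    \<open>U j\<close> even if \<open>V\<close> is not.\<close>
  have secc: "continuous_on (U j) (\<lambda>x. (\<epsilon> * \<sigma> j x) *\<^sub>R V x)" if j: "j \<in> I" for j \<epsilon>
  proof -
    have "continuous_on (U j) (\<lambda>x. \<phi> i x * (\<sigma> i x * \<sigma> j x))" if i: "i \<in> I" for i
      by (rule continuous_on_bump_mult[where U="U i"])
        (use \<phi>c \<phi>nz opU co i j sg in \<open>auto simp: abs_mult\<close>)
    then have "continuous_on (U j) (\<lambda>x. \<Sum>i\<in>I. (\<epsilon> * (\<phi> i x * (\<sigma> i x * \<sigma> j x))) *\<^sub>R unit_bcontfun i)"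
      by (intro continuous_on_sum continuous_on_scaleR continuous_on_mult_left continuous_on_const)
    moreover have "(\<Sum>i\<in>I. (\<epsilon> * (\<phi> i x * (\<sigma> i x * \<sigma> j x))) *\<^sub>R unit_bcontfun i) = (\<epsilon> * \<sigma> j x) *\<^sub>R V x" for x
      by (simp add: V_def scaleR_sum_right mult_ac)
    ultimately show ?thesis by simp
  qed
  define E where "E = {(x, \<epsilon> *\<^sub>R V x) | x \<epsilon>. x \<in> S \<and> \<bar>\<epsilon>\<bar> = 1}"
  define sheet where "sheet j \<epsilon> = (\<lambda>x. (x, (\<epsilon> * \<sigma> j x) *\<^sub>R V x)) ` U j" for j \<epsilon>
  have US: "U j \<subseteq> S" if "j \<in> I" for j using that cov by blast
  have covE: "covering_space E fst S"
  proof
    show "continuous_on E fst" by (intro continuous_intros)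
    show "fst ` E = S" 
    proof
      show "S \<subseteq> fst ` E"
      proof
        fix x assume "x \<in> S"
        then have "(x, 1 *\<^sub>R V x) \<in> E" unfolding E_def by (intro CollectI exI[of _ x] exI[of _ "1::real"] conjI) auto
        then show "x \<in> fst ` E" by (rule image_eqI[rotated]) simp
      qed
    qed (auto simp: E_def)
  next
    fix x assume "x \<in> S"
    then obtain j where j: "j \<in> I" "x \<in> U j" using cov by blast
    \<comment> \<open>On the sheet of \<open>\<epsilon>\<close> the \<open>j\<close>-th coordinate
      is \<open>\<epsilon> * \<phi> j\<close>, so its sign tells the two sheets apart. This is an
      open condition, hence both sheets are open and disjoint.\<close>
    have sheet_eq: "sheet j \<epsilon> = E \<inter> fst -` U j \<inter> {z. \<epsilon> * apply_bcontfun (snd z) j > 0}"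
      if e: "\<epsilon> = 1 \<or> \<epsilon> = -1" for \<epsilon>
    proof (intro equalityI subsetI)
      fix z assume "z \<in> sheet j \<epsilon>"
      then obtain y where y: "y \<in> U j" "z = (y, (\<epsilon> * \<sigma> j y) *\<^sub>R V y)"
        by (auto simp: sheet_def)
      have "\<epsilon> * apply_bcontfun (snd z) j = (\<epsilon> * \<epsilon>) * (\<sigma> j y * \<sigma> j y) * \<phi> j y"
        using y by (simp add: scaleR_bcontfun.rep_eq Vap j)
      also have "\<dots> = \<phi> j y" using e sg2[OF j(1) y(1)] by auto
      also have "\<dots> > 0" using \<phi>nz[OF j(1), of y] \<phi>ge[of j y] y by linarith
      finally show "z \<in> E \<inter> fst -` U j \<inter> {z. \<epsilon> * apply_bcontfun (snd z) j > 0}"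
        using y US[OF j(1)] e sg[OF j(1) y(1)] unfolding E_def
        by (intro IntI CollectI exI[of _ y] exI[of _ "\<epsilon> * \<sigma> j y"] conjI) (auto simp: abs_mult)
    next
      fix z assume z: "z \<in> E \<inter> fst -` U j \<inter> {z. \<epsilon> * apply_bcontfun (snd z) j > 0}"
      then obtain y \<delta> where y: "z = (y, \<delta> *\<^sub>R V y)" "\<bar>\<delta>\<bar> = 1"
        unfolding E_def by blast
      with z have yU: "y \<in> U j" and pos: "\<epsilon> * apply_bcontfun (snd z) j > 0" by auto
      have "0 < \<epsilon> * (\<delta> * (\<phi> j y * \<sigma> j y))"
        using pos y by (simp add: scaleR_bcontfun.rep_eq Vap j)
      then have "\<delta> = \<epsilon> * \<sigma> j y"
        using e y(2) sg[OF j(1) yU] \<phi>ge[of j y]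
        by (auto simp: abs_if zero_less_mult_iff split: if_splits)
      then show "z \<in> sheet j \<epsilon>" using y yU unfolding sheet_def by blast
    qed
    have E2: "E \<inter> fst -` U j = sheet j 1 \<union> sheet j (-1)"
    proof (intro equalityI subsetI)
      fix z assume z: "z \<in> E \<inter> fst -` U j"
      then obtain y \<delta> where y: "z = (y, \<delta> *\<^sub>R V y)" "\<bar>\<delta>\<bar> = 1"
        unfolding E_def by blast
      with z have yU: "y \<in> U j" by auto
      have "\<delta> = 1 * \<sigma> j y \<or> \<delta> = -1 * \<sigma> j y"
        using y(2) sg[OF j(1) yU] by (auto simp: abs_if split: if_splits)
      then show "z \<in> sheet j 1 \<union> sheet j (-1)"
        using y yU unfolding sheet_def by blast
    qed (use sheet_eq in auto)
    have op: "openin (top_of_set E) (sheet j \<epsilon>)" if e: "\<epsilon> = 1 \<or> \<epsilon> = -1" for \<epsilon>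
    proof -
      have "open (fst -` U j \<inter> {z :: 'a \<times> (nat \<Rightarrow>\<^sub>C real). 0 < \<epsilon> * apply_bcontfun (snd z) j})"
        by (intro open_Int open_vimage_fst opU j open_Collect_less continuous_intros
            continuous_on_apply_bcontfun_at)
      then show ?thesis
        unfolding sheet_eq[OF e] Int_assoc by (rule openin_open_Int)
    qed
    have hom: "homeomorphism (sheet j \<epsilon>) (U j) fst (\<lambda>x. (x, (\<epsilon> * \<sigma> j x) *\<^sub>R V x))" for \<epsilon>
      unfolding homeomorphism_def
      by (auto simp: sheet_def image_image intro!: continuous_intros secc j)
    have "sheet j 1 \<inter> sheet j (-1) = {}"
      unfolding sheet_eq[of 1, simplified] sheet_eq[of "-1", simplified] by auto
    then have "pairwise disjnt {sheet j 1, sheet j (-1)}"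
      by (auto simp: pairwise_def disjnt_def)
    moreover have "\<Union> {sheet j 1, sheet j (-1)} = E \<inter> fst -` U j" using E2 by auto
    moreover have "\<forall>u\<in>{sheet j 1, sheet j (-1)}. openin (top_of_set E) u" using op by auto
    moreover have "\<forall>u\<in>{sheet j 1, sheet j (-1)}. \<exists>q. homeomorphism u (U j) fst q"
      using hom by blast
    moreover have "openin (top_of_set S) (U j)"
      using US[OF j(1)] opU[OF j(1)] by (simp add: open_subset)
    ultimately show "\<exists>T. x \<in> T \<and> openin (top_of_set S) T \<and>
        (\<exists>v. \<Union>v = E \<inter> fst -` T \<and> (\<forall>u\<in>v. openin (top_of_set E) u) \<and>
        pairwise disjnt v \<and> (\<forall>u\<in>v. \<exists>q. homeomorphism u T fst q))"
      using j(2) by blast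
  qed
  have "open S" using opU cov by blast
  then have lpc: "locally path_connected S" by (rule open_imp_locally_path_connected)
  \<comment> \<open>A lift of the identity is a section of the cover; the sign that it picks over
    \<open>x\<close> becomes \<open>s x\<close>.\<close>
  obtain g where gc: "continuous_on S g" and gE: "g \<in> S \<rightarrow> E" and gid: "\<And>y. y \<in> S \<Longrightarrow> y = fst (g y)"
  proof (rule covering_space_lift[OF covE sc lpc, of "\<lambda>x. x"])
    show "(\<lambda>x. x) \<in> S \<rightarrow> S" by simp
  qed (auto intro: continuous_on_id)
  have "\<exists>\<epsilon>. \<bar>\<epsilon>\<bar> = 1 \<and> g x = (x, \<epsilon> *\<^sub>R V x)" if "x \<in> S" for x
  proof -
    have "g x \<in> E" using gE that by (rule Pi_mem)
    then obtain y \<epsilon> where "g x = (y, \<epsilon> *\<^sub>R V y)" "\<bar>\<epsilon>\<bar> = 1" unfolding E_def by blast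
    then show ?thesis using gid[OF that] by auto
  qed
  then obtain s where s: "\<And>x. x \<in> S \<Longrightarrow> \<bar>s x\<bar> = 1 \<and> g x = (x, s x *\<^sub>R V x)"
    by metis
  show thesis
  proof (rule that[of s])
    show "\<bar>s x\<bar> = 1" if "x \<in> S" for x using s that by blast
    fix j assume j: "j \<in> I"
    \<comment> \<open>The \<open>j\<close>-th coordinate of the section is
      \<open>s x * \<phi> j x * \<sigma> j x\<close>; the bump is nonzero on \<open>U j\<close> and
      can be divided out.\<close>
    have "continuous_on (U j) (\<lambda>x. apply_bcontfun (snd (g x)) j / \<phi> j x)"
      using US[OF j] gc \<phi>nz[OF j] 
      by (intro continuous_intros continuous_on_apply_bcontfun_at \<phi>c) (auto intro: continuous_on_subset)
    moreover have "apply_bcontfun (snd (g x)) j / \<phi> j x = s x * \<sigma> j x" if "x \<in> U j" for x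
      using s[of x] US[OF j] that \<phi>nz[OF j, of x]
      by (auto simp: scaleR_bcontfun.rep_eq Vap j)
    ultimately show "continuous_on (U j) (\<lambda>x. s x * \<sigma> j x)"
      by (rule continuous_on_eq)
  qed
qed

text \<open>The index set is renumbered by an initial segment of \<open>nat\<close>, which indexes
  the coordinates of the embedding.\<close>

lemma sign_cocycle_trivial:
  fixes S :: "'a::euclidean_space set" and U :: "'i \<Rightarrow> 'a set" and \<sigma> :: "'i \<Rightarrow> 'a \<Rightarrow> real"
  assumes sc: "simply_connected S" and "finite I"
    and opU: "\<And>i. i \<in> I \<Longrightarrow> open (U i)" and cov: "(\<Union>i\<in>I. U i) = S"
    and sg: "\<And>i x. i \<in> I \<Longrightarrow> x \<in> U i \<Longrightarrow> \<bar>\<sigma> i x\<bar> = 1"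
    and co: "\<And>i j. i \<in> I \<Longrightarrow> j \<in> I \<Longrightarrow> continuous_on (U i \<inter> U j) (\<lambda>x. \<sigma> i x * \<sigma> j x)"
  obtains s where "\<And>x. x \<in> S \<Longrightarrow> \<bar>s x\<bar> = 1"
    "\<And>i. i \<in> I \<Longrightarrow> continuous_on (U i) (\<lambda>x. s x * \<sigma> i x)"
proof -
  obtain h :: "nat \<Rightarrow> 'i" and n where h: "bij_betw h {..<n} I"
    using ex_bij_betw_nat_finite[OF \<open>finite I\<close>] by (auto simp: lessThan_atLeast0)
  then have hI: "h i \<in> I" if "i < n" for i using that by (auto simp: bij_betw_def)
  obtain s where s: "\<And>x. x \<in> S \<Longrightarrow> \<bar>s x\<bar> = 1"
    "\<And>i. i \<in> {..<n} \<Longrightarrow> continuous_on (U (h i)) (\<lambda>x. s x * \<sigma> (h i) x)"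
  proof (rule sign_cocycle_trivial_nat[OF sc, of "{..<n}" "\<lambda>i. U (h i)" "\<lambda>i. \<sigma> (h i)"])
    show "(\<Union>i\<in>{..<n}. U (h i)) = S" using cov h by (auto simp: bij_betw_def)
  qed (use hI opU sg co in auto)
  show thesis
    by (rule that[of s]) (use s h in \<open>auto simp: bij_betw_def\<close>)
qed

section \<open>Two-colourings of graphs\<close>

text \<open>Real signs instead of abstract colours: a swap is a negation, and two colourings are
  compared by their product, which can serve as a transition function.\<close>

definition proper_2col :: "('a \<Rightarrow> 'a \<Rightarrow> bool) \<Rightarrow> 'a set \<Rightarrow> ('a \<Rightarrow> real) \<Rightarrow> bool"
  where "proper_2col R V c \<longleftrightarrow>
    (\<forall>K\<in>V. \<bar>c K\<bar> = 1) \<and> (\<forall>K\<in>V. \<forall>L\<in>V. R K L \<longrightarrow> c L = - c K)"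

text \<open>For a symmetric relation this is the usual notion. Closed subsets instead of paths give
  induction along arcs at once, and a proper closed subset is what the segment argument
  refutes.\<close>

definition graph_connected :: "('a \<Rightarrow> 'a \<Rightarrow> bool) \<Rightarrow> 'a set \<Rightarrow> bool"
  where "graph_connected R V \<longleftrightarrow>
    (\<forall>A\<subseteq>V. A \<noteq> {} \<longrightarrow> (\<forall>K\<in>A. \<forall>L\<in>V. R K L \<longrightarrow> L \<in> A) \<longrightarrow> A = V)"

lemma graph_connectedD:
  assumes "graph_connected R V" "A \<subseteq> V" "K \<in> A"
    and "\<And>K L. K \<in> A \<Longrightarrow> L \<in> V \<Longrightarrow> R K L \<Longrightarrow> L \<in> A"
  shows "A = V"
proof -
  have "A \<subseteq> V \<longrightarrow> A \<noteq> {} \<longrightarrow> (\<forall>K\<in>A. \<forall>L\<in>V. R K L \<longrightarrow> L \<in> A) \<longrightarrow> A = V"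
    using assms(1) unfolding graph_connected_def by (rule spec)
  then show ?thesis using assms(2-4) by blast
qed

text \<open>Along an arc both factors change sign, so the product is constant on a connected
  graph.\<close>

lemma proper_2col_unique:
  assumes "graph_connected R V" "proper_2col R V c" "proper_2col R V d" "K \<in> V" "L \<in> V"
  shows "c K * d K = c L * d L"
proof -
  let ?A = "{M \<in> V. c M * d M = c L * d L}"
  have "L \<in> ?A" using assms(5) by simp
  moreover have "N \<in> ?A" if "M \<in> ?A" "N \<in> V" "R M N" for M N
  proof -
    have "c N = - c M" "d N = - d M" using assms(2,3) that by (auto simp: proper_2col_def)
    then show ?thesis using that by simp
  qed
  ultimately have "?A = V"
    by (intro graph_connectedD[OF assms(1), where K = L]) blast+
  with assms(4) have "K \<in> ?A" by simp
  then show ?thesis by simp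
qed

lemma proper_2col_subset: "proper_2col R V c \<Longrightarrow> W \<subseteq> V \<Longrightarrow> proper_2col R W c"
  by (auto simp: proper_2col_def)

lemma continuous_on_locally_constant:
  assumes "\<And>x. x \<in> S \<Longrightarrow> \<exists>W. open W \<and> x \<in> W \<and> (\<forall>y\<in>W \<inter> S. f y = f x)"
  shows "continuous_on S f"
  unfolding continuous_on_def
proof
  fix x assume "x \<in> S"
  then obtain W where W: "open W" "x \<in> W" "\<And>y. y \<in> W \<inter> S \<Longrightarrow> f y = f x" using assms by metis
  then have "\<forall>\<^sub>F y in at x within S. f y = f x"
    unfolding eventually_at_topological by auto
  then show "(f \<longlongrightarrow> f x) (at x within S)" by (rule tendsto_eventually)
qed

text \<open>
  The cocycle compares a reference colouring of each star \<open>A\<close> with that of the star of \<open>x\<close>, on the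
  open set \<open>U A\<close> of the points whose star is contained in \<open>A\<close>.
\<close>
proposition local_2col_imp_global:
  fixes T :: "'a::euclidean_space set set" and S :: "'a set"
  defines "star \<equiv> \<lambda>x. {K \<in> T. x \<in> K}"
  assumes sc: "simply_connected S" and "open S"
    and "finite T" and cl: "\<And>K. K \<in> T \<Longrightarrow> closed K" and cov: "S \<subseteq> \<Union>T"
    and conn: "\<And>x. x \<in> S \<Longrightarrow> graph_connected R (star x)"
    and col: "\<And>x. x \<in> S \<Longrightarrow> \<exists>c. proper_2col R (star x) c"
    and KS: "\<And>K. K \<in> T \<Longrightarrow> connected (K \<inter> S)"
  shows "\<exists>c. proper_2col (\<lambda>K L. R K L \<and> K \<inter> L \<inter> S \<noteq> {}) T c"
proof -
  define I where "I = star ` S"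
  have "I \<subseteq> Pow T" by (auto simp: I_def star_def)
  then have "finite I" using \<open>finite T\<close> by (meson finite_Pow_iff finite_subset)
  obtain c where c: "\<And>A. A \<in> I \<Longrightarrow> proper_2col R A (c A)"
  proof -
    have "\<forall>A\<in>I. \<exists>c. proper_2col R A c" using col by (auto simp: I_def)
    then show ?thesis using that by metis
  qed
  define U where "U A = {x \<in> S. star x \<subseteq> A}" for A
  have opU: "open (U A)" for A
  proof -
    have "U A = S - \<Union>(T - A)" by (auto simp: U_def star_def)
    moreover have "closed (\<Union>(T - A))" using \<open>finite T\<close> cl by (intro closed_Union) auto
    ultimately show ?thesis using \<open>open S\<close> by (simp add: open_Diff)
  qed
  have self: "x \<in> U (star x)" "star x \<in> I" if "x \<in> S" for x
    using that by (auto simp: U_def I_def)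
  define k where "k x = (SOME K. K \<in> star x)" for x
  have k: "k x \<in> star x" if "x \<in> S" for x
  proof -
    have "\<exists>K. K \<in> star x" using cov that by (auto simp: star_def)
    then show ?thesis unfolding k_def by (rule someI_ex)
  qed
  \<comment> \<open>The sign between two references on \<open>star x\<close>. It is read at the
    arbitrary tetrahedron \<open>k x\<close>, which is harmless by uniqueness up to a swap.\<close>
  define \<sigma> where "\<sigma> A x = c A (k x) * c (star x) (k x)" for A x
  have cs: "proper_2col R (star x) (c A)" if "A \<in> I" "x \<in> U A" for A x
    using proper_2col_subset[OF c[OF that(1)]] that(2) by (simp add: U_def)
  have \<sigma>: "\<sigma> A x = c A K * c (star x) K" if "A \<in> I" "x \<in> U A" "K \<in> star x" for A x K
  proof -
    have x: "x \<in> S" using that by (simp add: U_def)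
    show ?thesis unfolding \<sigma>_def
      by (rule proper_2col_unique[OF conn[OF x] cs[OF that(1,2)] c[OF self(2)[OF x]] k[OF x] that(3)])
  qed
  have c1: "\<bar>c A K\<bar> = 1" if "A \<in> I" "K \<in> A" for A K
    using c that by (auto simp: proper_2col_def)
  have c2: "c A K * c A K = 1" if "A \<in> I" "K \<in> A" for A K
    using c1[OF that] by (metis abs_mult_self_eq mult_1)
  obtain s where s1: "\<And>x. x \<in> S \<Longrightarrow> \<bar>s x\<bar> = 1"
    and s2: "\<And>A. A \<in> I \<Longrightarrow> continuous_on (U A) (\<lambda>x. s x * \<sigma> A x)"
  proof (rule sign_cocycle_trivial[OF sc \<open>finite I\<close>, of U \<sigma>])
    show "open (U A)" for A by (rule opU)
    show "(\<Union>A\<in>I. U A) = S" using self by (auto simp: U_def)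
    show "\<bar>\<sigma> A x\<bar> = 1" if "A \<in> I" "x \<in> U A" for A x
    proof -
      have x: "x \<in> S" using that by (simp add: U_def)
      then have "k x \<in> A" using k that by (auto simp: U_def)
      then show ?thesis unfolding \<sigma>_def using c1 self k x that by (simp add: abs_mult)
    qed
    fix A B assume AB: "A \<in> I" "B \<in> I"
    show "continuous_on (U A \<inter> U B) (\<lambda>x. \<sigma> A x * \<sigma> B x)"
    proof (rule continuous_on_locally_constant)
      fix x assume x: "x \<in> U A \<inter> U B"
      then have xS: "x \<in> S" by (simp add: U_def)
      have eq: "\<sigma> A y * \<sigma> B y = c A K * c B K" if "y \<in> U A \<inter> U B" "K \<in> star y" for y K
      proof -
        have y: "y \<in> S" using that by (simp add: U_def)
        have "\<sigma> A y * \<sigma> B y = c A K * c B K * (c (star y) K * c (star y) K)"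
          using \<sigma>[OF AB(1), of y K] \<sigma>[OF AB(2), of y K] that by simp
        then show ?thesis using c2[OF self(2)[OF y] that(2)] by simp
      qed
      \<comment> \<open>Stars shrink near \<open>x\<close>: \<open>k y\<close> belongs to
        \<open>star x\<close> as well, so both products can be read at \<open>k y\<close>, where the
        colours of the local references have cancelled.\<close>
      have "\<sigma> A y * \<sigma> B y = \<sigma> A x * \<sigma> B x" if y: "y \<in> U (star x) \<inter> (U A \<inter> U B)" for y
      proof -
        have "k y \<in> star y" "star y \<subseteq> star x" using k y by (auto simp: U_def)
        then show ?thesis using eq[of y "k y"] eq[of x "k y"] x y by auto
      qed
      then show "\<exists>W. open W \<and> x \<in> W \<and> (\<forall>y\<in>W \<inter> (U A \<inter> U B). \<sigma> A y * \<sigma> B y = \<sigma> A x * \<sigma> B x)"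
        using opU[of "star x"] self(1)[OF xS] by (intro exI[of _ "U (star x)"] conjI) auto
    qed
  qed blast
  \<comment> \<open>\<open>s x\<close> corrects the reference colouring at \<open>x\<close>. The
    corrected colour of \<open>K\<close> will turn out to be the same from every point of
    \<open>K \<inter> S\<close>.\<close>
  define f where "f K x = s x * c (star x) K" for K x
  have fconst: "f K constant_on (K \<inter> S)" if K: "K \<in> T" for K
  proof (rule continuous_finite_range_constant[OF KS[OF K]])
    show "finite (f K ` (K \<inter> S))"
    proof (rule finite_subset)
      show "f K ` (K \<inter> S) \<subseteq> {1, -1}"
      proof
        fix z assume "z \<in> f K ` (K \<inter> S)"
        then obtain x where x: "x \<in> K" "x \<in> S" "z = f K x" by auto
        then have "\<bar>z\<bar> = 1"
          using s1[of x] c1[OF self(2), of x K] K by (simp add: f_def abs_mult star_def)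
        then show "z \<in> {1, -1}" by auto
      qed
    qed simp
    show "continuous_on (K \<inter> S) (f K)"
    proof (rule continuous_on_eq_continuous_within[THEN iffD2], rule ballI)
      fix x assume x: "x \<in> K \<inter> S"
      let ?A = "star x"
      \<comment> \<open>Near \<open>x\<close>, the colour \<open>f K\<close> is the continuous
        function of \<open>s2\<close> times the constant \<open>c (star x) K\<close>, because that
        constant squares to 1.\<close>
      have "continuous_on (U ?A \<inter> (K \<inter> S)) (\<lambda>y. (s y * \<sigma> ?A y) * c ?A K)"
        using s2[OF self(2)] x
        by (intro continuous_on_mult_right) (auto intro: continuous_on_subset)
      moreover have "(s y * \<sigma> ?A y) * c ?A K = f K y" if "y \<in> U ?A \<inter> (K \<inter> S)" for y
      proof -
        have "K \<in> star y" "K \<in> star x" using that x K by (auto simp: star_def)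
        have xS: "x \<in> S" using x by blast
        have "(s y * \<sigma> ?A y) * c ?A K = f K y * (c ?A K * c ?A K)"
          using \<sigma>[OF self(2)[OF xS], of y K] that \<open>K \<in> star y\<close> by (simp add: f_def)
        then show ?thesis
          using c2[OF self(2)[OF xS] \<open>K \<in> star x\<close>] by simp
      qed
      ultimately have "continuous_on (U ?A \<inter> (K \<inter> S)) (f K)"
        by (rule continuous_on_eq)
      then have "continuous (at x within U ?A \<inter> (K \<inter> S)) (f K)"
        using x self(1)[of x] by (auto simp: continuous_on_eq_continuous_within)
      moreover have "at x within U ?A \<inter> (K \<inter> S) = at x within K \<inter> S"
        by (rule at_within_nhd[of x "U ?A"]) (use opU self(1)[of x] x in blast)+
      ultimately show "continuous (at x within K \<inter> S) (f K)" by simp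
    qed
  qed
  \<comment> \<open>The default 1 is safe: a set that misses \<open>S\<close> has no arcs in the
    restricted relation.\<close>
  define d where "d K = (if K \<inter> S = {} then 1 else f K (SOME x. x \<in> K \<inter> S))" for K
  have "proper_2col (\<lambda>K L. R K L \<and> K \<inter> L \<inter> S \<noteq> {}) T d"
    unfolding proper_2col_def
  proof (intro conjI ballI impI)
    have val: "d K = f K x"
      if "K \<in> T" "x \<in> K \<inter> S" for K x
    proof -
      have "(SOME x. x \<in> K \<inter> S) \<in> K \<inter> S" using that(2) by (rule someI)
      moreover have "\<exists>z. \<forall>y\<in>K \<inter> S. f K y = z"
        using fconst[OF that(1)] unfolding constant_on_def .
      ultimately show ?thesis using that(2) unfolding d_def by (metis emptyE)
    qed
    have fa: "\<bar>f K x\<bar> = 1" if "K \<in> T" "x \<in> K \<inter> S" for K x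
      using s1[of x] c1[OF self(2), of x K] that by (simp add: f_def abs_mult star_def)
    show "\<bar>d K\<bar> = 1" if "K \<in> T" for K
    proof (cases "K \<inter> S = {}")
      case False
      then obtain x where "x \<in> K \<inter> S" by blast
      with val[of K x] fa[of K x] that show ?thesis by simp
    qed (simp add: d_def)
    fix K L assume KL: "K \<in> T" "L \<in> T" "R K L \<and> K \<inter> L \<inter> S \<noteq> {}"
    then obtain x where x: "x \<in> K" "x \<in> L" "x \<in> S" by blast
    have "f L x = - f K x"
      using c[OF self(2)[OF x(3)]] KL x by (auto simp: proper_2col_def f_def star_def)
    then show "d L = - d K"
      using val[of K x] val[of L x] KL x by simp
  qed
  then show ?thesis by blast
qed

text \<open>Double counting: reversal matches the arcs that leave one colour class with those that
  leave the other, so \<open>2 * card P = 2 * card N\<close>.\<close>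

lemma two_regular_2col_imp_even_card:
  assumes "finite V" and sym: "\<And>x y. x \<in> V \<Longrightarrow> y \<in> V \<Longrightarrow> R x y \<Longrightarrow> R y x"
    and deg: "\<And>x. x \<in> V \<Longrightarrow> card {y \<in> V. R x y} = 2"
    and c: "proper_2col R V c"
  shows "even (card V)"
proof -
  define P where "P = {x \<in> V. c x = 1}"
  define N where "N = {x \<in> V. c x = -1}"
  have fin: "finite P" "finite N" using \<open>finite V\<close> by (auto simp: P_def N_def)
  have c1: "c x = 1 \<or> c x = -1" if "x \<in> V" for x
  proof -
    have "\<bar>c x\<bar> = 1" using c that by (auto simp: proper_2col_def)
    then show ?thesis by linarith
  qed
  have cR: "c y = - c x" if "x \<in> V" "y \<in> V" "R x y" for x y
    using c that by (auto simp: proper_2col_def)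
  have VPN: "V = P \<union> N" "P \<inter> N = {}" using c1 by (auto simp: P_def N_def)
  have dP: "card (SIGMA x:P. {y \<in> V. R x y}) = 2 * card P"
    using fin \<open>finite V\<close> deg by (simp add: P_def)
  have dN: "card (SIGMA x:N. {y \<in> V. R x y}) = 2 * card N"
    using fin \<open>finite V\<close> deg by (simp add: N_def)
  have "prod.swap ` (SIGMA x:P. {y \<in> V. R x y}) = (SIGMA x:N. {y \<in> V. R x y})" (is "?L = ?R")
  proof
    show "?L \<subseteq> ?R"
    proof
      fix z assume "z \<in> ?L"
      then obtain x y where z: "z = (y, x)" "x \<in> V" "c x = 1" "y \<in> V" "R x y"
        by (auto simp: P_def)
      then show "z \<in> ?R" using sym[of x y] cR[of x y] by (simp add: N_def)
    qed
    show "?R \<subseteq> ?L"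
    proof
      fix z assume "z \<in> ?R"
      then obtain x y where z: "z = (x, y)" "x \<in> V" "c x = -1" "y \<in> V" "R x y"
        by (auto simp: N_def)
      then have "(y, x) \<in> (SIGMA x:P. {y \<in> V. R x y})"
        using sym[of x y] cR[of x y] by (auto simp: P_def)
      then show "z \<in> ?L" using z by (metis image_eqI swap_simp)
    qed
  qed
  moreover have "card ?L = card (SIGMA x:P. {y \<in> V. R x y})"
    by (intro card_image inj_swap)
  ultimately have "card ?R = card (SIGMA x:P. {y \<in> V. R x y})" by (simp only:)
  then have "card P = card N" using dP dN by simp
  then show ?thesis using card_Un_disjoint[OF fin VPN(2)] VPN(1) by simp
qed

text \<open>Leave each vertex through the edge not used to enter it.\<close>
lemma two_regular_walk:
  assumes deg: "\<And>x. x \<in> V \<Longrightarrow> card {y \<in> V. R x y} = 2" and "v \<in> V"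
    and sym: "\<And>x y. x \<in> V \<Longrightarrow> y \<in> V \<Longrightarrow> R x y \<Longrightarrow> R y x"
  obtains u :: "nat \<Rightarrow> 'a" where "\<And>n. u n \<in> V" "\<And>n. {y \<in> V. R (u (Suc n)) y} = {u n, u (Suc (Suc n))}"
    "\<And>n. u (Suc (Suc n)) \<noteq> u n" "u 0 = v"
proof -
  \<comment> \<open>The states of the walk are arcs, since the next vertex depends on the last
    two.\<close>
  define P where "P p \<longleftrightarrow> fst p \<in> V \<and> snd p \<in> V \<and> R (fst p) (snd p)" for p
  define Q where "Q p q \<longleftrightarrow> fst q = snd p \<and> snd q \<noteq> fst p" for p q :: "'a \<times> 'a"
  have "\<exists>f. \<forall>n. (P (f n) \<and> (n = 0 \<longrightarrow> fst (f n) = v)) \<and> Q (f n) (f (Suc n))"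
  proof (rule dependent_nat_choice)
    have "{y \<in> V. R v y} \<noteq> {}" using deg[OF \<open>v \<in> V\<close>] by fastforce
    then obtain w where "w \<in> V" "R v w" by blast
    then show "\<exists>p. P p \<and> (0 = 0 \<longrightarrow> fst p = v)" using \<open>v \<in> V\<close>
      by (intro exI[of _ "(v, w)"]) (auto simp: P_def)
  next
    fix p and n :: nat assume p: "P p \<and> (n = 0 \<longrightarrow> fst p = v)"
    have "\<not> {y \<in> V. R (snd p) y} \<subseteq> {fst p}"
    proof
      assume "{y \<in> V. R (snd p) y} \<subseteq> {fst p}"
      then have "card {y \<in> V. R (snd p) y} \<le> 1" using card_mono[of "{fst p}"] by simp
      then show False using deg[of "snd p"] p by (simp add: P_def)
    qed
    then obtain z where "z \<in> V" "R (snd p) z" "z \<noteq> fst p" by blast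
    then show "\<exists>q. (P q \<and> (Suc n = 0 \<longrightarrow> fst q = v)) \<and> Q p q" using p
      by (intro exI[of _ "(snd p, z)"]) (auto simp: P_def Q_def)
  qed
  then obtain f where f: "\<And>n. P (f n)" "\<And>n. Q (f n) (f (Suc n))" "fst (f 0) = v" by blast
  show thesis
  proof (rule that[of "\<lambda>n. fst (f n)"])
    show inV: "fst (f n) \<in> V" for n using f(1)[of n] by (simp add: P_def)
    show ne: "fst (f (Suc (Suc n))) \<noteq> fst (f n)" for n
      using f(2)[of n] f(2)[of "Suc n"] by (auto simp: Q_def)
    have R: "R (fst (f n)) (fst (f (Suc n)))" for n
      using f(1)[of n] f(2)[of n] by (simp add: P_def Q_def)
    show "{y \<in> V. R (fst (f (Suc n))) y} = {fst (f n), fst (f (Suc (Suc n)))}" for n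
    proof (rule card_subset_eq[symmetric])
      show "finite {y \<in> V. R (fst (f (Suc n))) y}"
        using deg[OF inV[of "Suc n"]] by (intro card_ge_0_finite) simp
      show "{fst (f n), fst (f (Suc (Suc n)))} \<subseteq> {y \<in> V. R (fst (f (Suc n))) y}"
        using inV R[of n] R[of "Suc n"] sym by auto
      show "card {fst (f n), fst (f (Suc (Suc n)))} = card {y \<in> V. R (fst (f (Suc n))) y}"
        using deg[OF inV[of "Suc n"]] ne[of n] by simp
    qed
  qed (use f(3) in simp)
qed

text \<open>The walk first repeats a vertex by returning to its start. The resulting cycle is closed
  under adjacency, hence is all of \<open>V\<close>, and alternating signs close up because its
  length \<open>m\<close> is even.\<close>

lemma two_regular_even_imp_2col:
  assumes "finite V" and sym: "\<And>x y. x \<in> V \<Longrightarrow> y \<in> V \<Longrightarrow> R x y \<Longrightarrow> R y x"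
    and irr: "\<And>x. x \<in> V \<Longrightarrow> \<not> R x x"
    and deg: "\<And>x. x \<in> V \<Longrightarrow> card {y \<in> V. R x y} = 2"
    and conn: "graph_connected R V" and ev: "even (card V)"
  shows "\<exists>c. proper_2col R V c"
proof (cases "V = {}")
  case True
  then show ?thesis by (simp add: proper_2col_def)
next
  case False
  then obtain v where "v \<in> V" by blast
  obtain u :: "nat \<Rightarrow> 'a" where uV: "\<And>n. u n \<in> V"
    and nb: "\<And>n. {y \<in> V. R (u (Suc n)) y} = {u n, u (Suc (Suc n))}"
    and ne2: "\<And>n. u (Suc (Suc n)) \<noteq> u n"
  proof (rule two_regular_walk[of V R v])
    show "card {y \<in> V. R x y} = 2" if "x \<in> V" for x using deg that .
    show "R y x" if "x \<in> V" "y \<in> V" "R x y" for x y using sym that by blast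
  qed (use \<open>v \<in> V\<close> in blast)+
  have R1: "R (u n) (u (Suc n))" for n
    using nb[of n] sym[of "u (Suc n)" "u n"] uV by blast
  then have ne1: "u (Suc n) \<noteq> u n" for n using irr uV by metis
  have "\<not> inj u"
  proof
    assume "inj u"
    then have "infinite (range u)" by (simp add: finite_image_iff)
    then show False using uV \<open>finite V\<close> by (meson finite_subset image_subsetI)
  qed
  then obtain i j where "i < j" "u i = u j" unfolding inj_def by (metis linorder_neqE_nat)
  define m where "m = (LEAST j. \<exists>i<j. u i = u j)"
  have "\<exists>i<m. u i = u m" unfolding m_def
    by (rule LeastI[of "\<lambda>j. \<exists>i<j. u i = u j" j]) (use \<open>i < j\<close> \<open>u i = u j\<close> in blast)
  then obtain k where k: "k < m" "u k = u m" by blast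
  have inj: "inj_on u {..<m}"
  proof (rule linorder_inj_onI)
    show "u x \<noteq> u y" if "x < y" "x \<in> {..<m}" "y \<in> {..<m}" for x y
      using not_less_Least[of y "\<lambda>j. \<exists>i<j. u i = u j"] that unfolding m_def[symmetric] by auto
  qed auto
  \<comment> \<open>Without loops and immediate returns a cycle has at least three vertices, which
    will make \<open>u 1\<close> and \<open>u m'\<close> distinct.\<close>
  have m3: "m \<ge> 3"
  proof -
    have "m \<noteq> Suc k" "m \<noteq> Suc (Suc k)" using k ne1[of k] ne2[of k] by auto
    then show ?thesis using k by linarith
  qed
  then obtain m' where m': "m = Suc m'" "m' \<ge> 2" by (metis Suc_le_D Suc_le_mono numeral_2_eq_2 numeral_3_eq_3)
  \<comment> \<open>A return to a later position \<open>k\<close> would give \<open>u k\<close> the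
    third neighbour \<open>u m'\<close>, besides its predecessor and successor.\<close>
  have "k = 0"
  proof (rule ccontr)
    assume "k \<noteq> 0"
    then obtain k' where k': "k = Suc k'" by (metis not0_implies_Suc)
    have "u m' \<in> {y \<in> V. R (u k) y}"
      using k sym[OF uV uV R1[of m']] uV m' by simp
    then have "u m' = u k' \<or> u m' = u (Suc k)" using nb[of k'] k' by blast
    moreover have "Suc k < m" using k ne1[of k] by (metis Suc_lessI)
    ultimately have "m' = k' \<or> m' = Suc k"
      using inj_onD[OF inj, of m' k'] inj_onD[OF inj, of m' "Suc k"] k(1) k' m'(1) by auto
    then show False using k k' m' ne2[of k] by auto
  qed
  then have um: "u m = u 0" using k by simp
  \<comment> \<open>\<open>nb\<close> covers only positions with a predecessor; on the closed cycle
    the start is preceded by position \<open>m'\<close>.\<close>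
  have nb0: "{y \<in> V. R (u 0) y} = {u m', u 1}"
  proof (rule card_subset_eq[symmetric])
    show "finite {y \<in> V. R (u 0) y}" using \<open>finite V\<close> by simp
    show "{u m', u 1} \<subseteq> {y \<in> V. R (u 0) y}"
      using uV R1[of 0] sym[OF uV uV R1[of m']] um m' by auto
    have "u m' \<noteq> u 1" using inj_onD[OF inj, of m' 1] m' by auto
    then show "card {u m', u 1} = card {y \<in> V. R (u 0) y}" using deg[OF uV] by simp
  qed
  have step: "\<exists>j<m. y = u j \<and> (j = Suc i \<or> i = Suc j \<or> (i = 0 \<and> j = m') \<or> (i = m' \<and> j = 0))"
    if i: "i < m" "y \<in> V" "R (u i) y" for i y
  proof (cases i)
    case 0
    then have "y = u m' \<or> y = u 1" using nb0 that by blast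
    moreover have "m' < m" "1 < m" using m' by auto
    ultimately show ?thesis using 0 by (metis One_nat_def)
  next
    case (Suc i')
    then have y: "y = u i' \<or> y = u (Suc i)" using nb[of i'] that by blast
    show ?thesis
    proof (cases "Suc i = m")
      case True
      then have "y = u i' \<or> y = u 0" using y um by auto
      moreover have "i = m'" "i' < m" "0 < m" using True m' Suc i by auto
      ultimately show ?thesis using Suc by blast
    next
      case False
      then have "Suc i < m" "i' < m" using i Suc by auto
      then show ?thesis using y Suc by blast
    qed
  qed
  have UV: "u ` {..<m} = V"
  proof (rule graph_connectedD[OF conn, of _ "u 0"])
    show "u ` {..<m} \<subseteq> V" using uV by auto
    show "u 0 \<in> u ` {..<m}" using m' by auto
    show "L \<in> u ` {..<m}" if "K \<in> u ` {..<m}" "L \<in> V" "R K L" for K L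
      using step that by fastforce
  qed
  then have "card V = m" using card_image[OF inj] by simp
  then have odd: "odd m'" using ev m' by simp
  \<comment> \<open>The colour is the parity of the position on the cycle. Arcs join consecutive
    positions or wrap around between 0 and \<open>m'\<close>, which is odd.\<close>
  define c where "c x = (-1 :: real) ^ inv_into {..<m} u x" for x
  have cu: "c (u i) = (-1) ^ i" if "i < m" for i
    unfolding c_def using inv_into_f_f[OF inj] that by simp
  have "proper_2col R V c" unfolding proper_2col_def
  proof (intro conjI ballI impI)
    fix K assume "K \<in> V"
    show "\<bar>c K\<bar> = 1" by (simp add: c_def power_abs)
    fix L assume L: "L \<in> V" "R K L"
    obtain i where i: "i < m" "K = u i" using \<open>K \<in> V\<close> UV by blast
    obtain j where j: "j < m" "L = u j"
      and cases: "j = Suc i \<or> i = Suc j \<or> (i = 0 \<and> j = m') \<or> (i = m' \<and> j = 0)"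
      using step[of i L] i L by blast
    have "(-1 :: real) ^ j = - ((-1) ^ i)"
      using cases odd by auto
    then show "c L = - c K" using cu i j by simp
  qed
  then show ?thesis by blast
qed

section \<open>Geometry of facets and edges\<close>

text \<open>Project \<open>y\<close> from \<open>q\<close> to the hyperplane: the image \<open>g y\<close> lies in \<open>F\<close> and \<open>y\<close> between \<open>q\<close> and \<open>g y\<close>.\<close>
lemma half_ball_subset:
  fixes K F :: "'a::euclidean_space set"
  assumes "convex K" "F \<subseteq> K" and z: "z \<in> rel_interior F"
    and aff: "affine hull F = {y. a \<bullet> y = b}" and q: "q \<in> K" "a \<bullet> q < b"
  obtains r where "r > 0" "ball z r \<inter> {y. a \<bullet> y \<le> b} \<subseteq> K"
proof -
  obtain \<epsilon> where \<epsilon>: "\<epsilon> > 0" "ball z \<epsilon> \<inter> {y. a \<bullet> y = b} \<subseteq> F"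
    using z by (auto simp: mem_rel_interior_ball aff)
  have az: "a \<bullet> z = b"
    using z rel_interior_subset hull_subset[of F affine] aff by blast
  define s where "s y = (b - a \<bullet> q) / (a \<bullet> y - a \<bullet> q)" for y
  define g where "g y = q + s y *\<^sub>R (y - q)" for y
  have "isCont g z"
    unfolding g_def s_def using az q by (intro continuous_intros) auto
  moreover have "g z = z" using az q by (simp add: g_def s_def)
  ultimately obtain d where d: "d > 0" "\<And>y. dist y z < d \<Longrightarrow> dist (g y) z < \<epsilon>"
    using \<epsilon>(1) unfolding continuous_at_eps_delta by metis
  \<comment> \<open>The second radius keeps \<open>y\<close> strictly beyond the level of
    \<open>q\<close>, so that the denominator of \<open>s y\<close> is positive.\<close>
  have "isCont (\<lambda>y. a \<bullet> y) z" by (intro continuous_intros)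
  then obtain d' where d': "d' > 0" "\<And>y. dist y z < d' \<Longrightarrow> dist (a \<bullet> y) (a \<bullet> z) < b - a \<bullet> q"
    using q unfolding continuous_at_eps_delta by (metis diff_gt_0_iff_gt)
  show thesis
  proof (rule that[of "min d d'"])
    show "ball z (min d d') \<inter> {y. a \<bullet> y \<le> b} \<subseteq> K"
    proof
      fix y assume "y \<in> ball z (min d d') \<inter> {y. a \<bullet> y \<le> b}"
      then have y: "dist y z < d" "dist y z < d'" "a \<bullet> y \<le> b" by (auto simp: dist_commute)
      have gt: "a \<bullet> y > a \<bullet> q" using d'(2)[OF y(2)] az by (simp add: dist_real_def)
      have s1: "s y \<ge> 1" using gt y(3) by (simp add: s_def)
      have "a \<bullet> g y = b"
        using gt by (simp add: g_def s_def inner_simps)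
      moreover have "g y \<in> ball z \<epsilon>" using d(2)[OF y(1)] by (simp add: dist_commute)
      ultimately have "g y \<in> K" using \<epsilon> \<open>F \<subseteq> K\<close> by blast
      then have "(1 - 1 / s y) *\<^sub>R q + (1 / s y) *\<^sub>R g y \<in> K"
        using \<open>convex K\<close> q s1 by (intro convexD) auto
      moreover have "(1 - 1 / s y) *\<^sub>R q + (1 / s y) *\<^sub>R g y = y"
        using s1 by (simp add: g_def algebra_simps)
      ultimately show "y \<in> K" by simp
    qed
  qed (use d d' in auto)
qed

text \<open>A facet is spanned by all vertices but one, and it contains the edge exactly if the
  omitted vertex is not an end of the edge: 4 - 2 choices.\<close>

lemma simplex_facets_containing_edge:
  fixes K e :: "'a::euclidean_space set"
  assumes K: "3 simplex K" and e: "e face_of K" "aff_dim e = 1"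
  shows "card {F. F facet_of K \<and> e \<subseteq> F} = 2"
proof -
  obtain C where C: "finite C" "\<not> affine_dependent C" "card C = 4" "K = convex hull C"
    using K by (auto simp: simplex)
  obtain E where E: "E \<subseteq> C" "e = convex hull E"
    using e face_of_convex_hull_affine_independent[OF C(2)] C(4) by auto
  have "\<not> affine_dependent E" using C(2) E(1) affine_dependent_subset by blast
  then have cE: "card E = 2"
    using e(2) E(2) aff_dim_affine_independent[of E] by (simp add: aff_dim_convex_hull)
  have sub: "e \<subseteq> convex hull (C - {u}) \<longleftrightarrow> u \<notin> E" if "u \<in> C" for u
  proof
    assume *: "e \<subseteq> convex hull (C - {u})"
    show "u \<notin> E"
    proof
      assume "u \<in> E"
      then have "u \<in> convex hull (C - {u})" using * E(2) hull_subset[of E convex] by blast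
      then have "u \<in> affine hull (C - {u})" using convex_hull_subset_affine_hull by blast
      then show False using C(2) that by (auto simp: affine_dependent_def)
    qed
  next
    assume "u \<notin> E"
    then show "e \<subseteq> convex hull (C - {u})" using E by (auto intro!: hull_mono)
  qed
  have "{F. F facet_of K \<and> e \<subseteq> F} = (\<lambda>u. convex hull (C - {u})) ` (C - E)"
    using facet_of_convex_hull_affine_independent_alt[OF C(2)] C(3,4) sub by auto
  moreover have "inj_on (\<lambda>u. convex hull (C - {u})) (C - E)"
  proof (rule inj_onI, rule ccontr)
    fix u v assume uv: "u \<in> C - E" "v \<in> C - E" "convex hull (C - {u}) = convex hull (C - {v})" "u \<noteq> v"
    then have "u \<in> convex hull (C - {v})" by (auto intro: hull_inc)
    then have "u \<in> affine hull (C - {u})" using uv convex_hull_subset_affine_hull by blast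
    then show False using C(2) uv by (auto simp: affine_dependent_def)
  qed
  ultimately show ?thesis
    using C E cE by (simp add: card_image card_Diff_subset finite_subset)
qed

lemma finite_closed_cover_local:
  fixes T :: "'a::metric_space set set"
  assumes "finite T" "\<And>K. K \<in> T \<Longrightarrow> closed K"
  obtains r where "r > 0" "\<And>K. K \<in> T \<Longrightarrow> K \<inter> ball x r \<noteq> {} \<Longrightarrow> x \<in> K"
proof -
  have "open (- \<Union>{K \<in> T. x \<notin> K})"
    using assms by (intro open_Compl closed_Union) auto
  moreover have "x \<in> - \<Union>{K \<in> T. x \<notin> K}" by auto
  ultimately obtain r where "r > 0" "ball x r \<subseteq> - \<Union>{K \<in> T. x \<notin> K}"
    by (meson open_contains_ball)
  then show thesis using that[of r] by blast
qed

text \<open>If the segment meets \<open>e\<close> in \<open>z\<close>, then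
  \<open>z \<noteq> p\<close>, so \<open>q\<close> lies on the line through \<open>p\<close> and
  \<open>z\<close> and thus in the affine hull of \<open>insert p e\<close>. These hulls have
  dimension at most 2 and cannot cover an open set.\<close>

lemma exists_segment_avoiding_lines:
  fixes p :: "'a::euclidean_space"
  assumes "3 \<le> DIM('a)" "finite \<E>" and dim: "\<And>e. e \<in> \<E> \<Longrightarrow> aff_dim e \<le> 1"
    and "open U" "U \<noteq> {}" and p: "p \<notin> \<Union>\<E>"
  obtains q where "q \<in> U" "closed_segment p q \<inter> \<Union>\<E> = {}"
proof -
  have "negligible (affine hull (insert p e))" if "e \<in> \<E>" for e
  proof -
    have "aff_dim (insert p e) \<le> 2"
      using dim[OF that] by (auto simp: aff_dim_insert)
    then have "interior (affine hull (insert p e)) = {}"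
      using aff_dim_nonempty_interior[of "affine hull (insert p e)"] assms(1)
      by (cases "interior (affine hull (insert p e)) = {}") auto
    then show ?thesis
      using negligible_convex_interior by (metis affine_affine_hull affine_imp_convex)
  qed
  then have "negligible (\<Union>e\<in>\<E>. affine hull (insert p e))"
    using \<open>finite \<E>\<close> by (intro negligible_Union) auto
  then have "\<not> U \<subseteq> (\<Union>e\<in>\<E>. affine hull (insert p e))"
    using open_not_negligible[OF \<open>open U\<close> \<open>U \<noteq> {}\<close>] negligible_subset by blast
  then obtain q where q: "q \<in> U" "\<And>e. e \<in> \<E> \<Longrightarrow> q \<notin> affine hull (insert p e)" by blast
  have "z \<notin> e" if z: "z \<in> closed_segment p q" and e: "e \<in> \<E>" for z e
  proof
    assume "z \<in> e"
    obtain t where t: "z = (1 - t) *\<^sub>R p + t *\<^sub>R q"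
      using z by (auto simp: in_segment)
    have "t \<noteq> 0" using t p e \<open>z \<in> e\<close> by auto
    then have "(1/t) * (1 - t) = 1/t - 1" by (simp add: field_simps)
    then have "q = (1 - 1/t) *\<^sub>R p + (1/t) *\<^sub>R z"
      unfolding t scaleR_add_right scaleR_scaleR using \<open>t \<noteq> 0\<close>
      by (simp add: scaleR_left_diff_distrib)
    moreover have "p \<in> affine hull (insert p e)" "z \<in> affine hull (insert p e)"
      using \<open>z \<in> e\<close> by (auto intro: hull_inc)
    ultimately have "q \<in> affine hull (insert p e)"
      using mem_affine[OF affine_affine_hull, of p "insert p e" z "1 - 1/t" "1/t"] by simp
    then show False using q e by blast
  qed
  then show thesis using that[OF q(1)] by blast
qed

section \<open>Tetrahedral meshes\<close>

locale mesh =
  fixes T :: "(real^3) set set" and \<Omega> :: "(real^3) set"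
  assumes finT: "finite T"
    and simplex3: "K \<in> T \<Longrightarrow> 3 simplex K"
    and Int_face: "K \<in> T \<Longrightarrow> L \<in> T \<Longrightarrow> K \<inter> L face_of K"
    and opn: "open \<Omega>" and regular: "interior (closure \<Omega>) = \<Omega>" and UnT: "\<Union>T = closure \<Omega>"
begin

definition star :: "real^3 \<Rightarrow> (real^3) set set" where "star x = {K \<in> T. x \<in> K}"

text \<open>The dimension of the intersection is visibly symmetric and works directly with
  conformity; \<open>mesh_graph_arc_iff\<close> identifies it with a common facet.\<close>

definition adj :: "(real^3) set \<Rightarrow> (real^3) set \<Rightarrow> bool"
  where "adj K L \<longleftrightarrow> aff_dim (K \<inter> L) = 2"

section \<open>Tetrahedra, their intersections and their facets\<close>

lemma adj_sym: "adj K L \<Longrightarrow> adj L K"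
  by (simp add: adj_def Int_commute)

lemma tetrahedron:
  assumes "K \<in> T"
  shows "convex K" "compact K" "closed K" "polytope K" "aff_dim K = 3" "interior K \<noteq> {}"
    "closure (interior K) = K"
proof -
  have K: "3 simplex K" using assms by (rule simplex3)
  show cv: "convex K" "compact K" and cl: "closed K" and "polytope K" and d: "aff_dim K = 3"
    using K convex_simplex compact_simplex closed_simplex simplex_imp_polytope aff_dim_simplex by auto
  have "rel_interior K = interior K"
    using d by (intro rel_interior_interior) (simp add: affine_hull_UNIV aff_dim_eq_full[symmetric])
  moreover have "rel_interior K \<noteq> {}" using cv d rel_interior_eq_empty[of K] by fastforce
  ultimately show i: "interior K \<noteq> {}" by simp
  show "closure (interior K) = K"
    using convex_closure_interior[OF cv(1) i] cl by (simp add: closure_closed)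
qed

lemma not_adj_self: "K \<in> T \<Longrightarrow> \<not> adj K K"
  using tetrahedron(5) by (simp add: adj_def)

text \<open>\<open>K \<inter> L\<close> is a proper face of \<open>K\<close>: otherwise
  \<open>K\<close> would be a proper face of \<open>L\<close> of the same dimension.\<close>

lemma interior_Int:
  assumes "K \<in> T" "L \<in> T" "K \<noteq> L"
  shows "interior K \<inter> L = {}"
proof -
  have "K \<inter> L \<noteq> K"
  proof
    assume KL: "K \<inter> L = K"
    then have "K face_of L" using Int_face[OF assms(2,1)] by (simp add: Int_commute)
    then have "aff_dim K < aff_dim L"
      using assms tetrahedron(1) by (intro face_of_aff_dim_lt) auto
    then show False using tetrahedron(5) assms by simp
  qed
  then have "K \<inter> L \<inter> interior K = {}"
    using face_of_disjoint_interior[OF Int_face[OF assms(1,2)]] by blast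
  then show ?thesis using interior_subset by blast
qed

lemma interior_eqI:
  assumes "K \<in> T" "L \<in> T" "U \<subseteq> K" "U \<subseteq> L" "open U" "U \<noteq> {}"
  shows "K = L"
proof (rule ccontr)
  assume "K \<noteq> L"
  have "U \<subseteq> interior K" using assms by (intro interior_maximal) auto
  then show False using interior_Int[OF assms(1,2) \<open>K \<noteq> L\<close>] assms by blast
qed

lemma facetD:
  assumes "K \<in> T" "F facet_of K"
  shows "F face_of K" "F \<subseteq> K" "F \<noteq> {}" "aff_dim F = 2" "convex F" "rel_interior F \<noteq> {}"
proof -
  show F: "F face_of K" "F \<noteq> {}" "aff_dim F = 2"
    using assms tetrahedron(5) by (auto simp: facet_of_def)
  then show "F \<subseteq> K" "convex F" using face_of_imp_subset face_of_imp_convex by auto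
  with F show "rel_interior F \<noteq> {}" using rel_interior_eq_empty by blast
qed

lemma adj_facet:
  assumes "K \<in> T" "L \<in> T" "adj K L"
  shows "K \<inter> L facet_of K" "K \<inter> L facet_of L" "K \<noteq> L"
proof -
  have "K \<inter> L \<noteq> {}" using assms(3) by (auto simp: adj_def)
  then show "K \<inter> L facet_of K" "K \<inter> L facet_of L"
    using assms Int_face[of K L] Int_face[of L K] tetrahedron(5) 
    by (auto simp: facet_of_def adj_def Int_commute)
  show "K \<noteq> L" using not_adj_self assms by blast
qed

text \<open>\<open>F\<close> is a two-dimensional face of \<open>K \<inter> L\<close>, whose
  dimension is below 3; a proper face would have smaller dimension.\<close>

lemma facet_Int_eq:
  assumes "K \<in> T" "L \<in> T" "K \<noteq> L" "F facet_of K" "F \<subseteq> L"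
  shows "K \<inter> L = F" "adj K L"
proof -
  have F: "F \<subseteq> K \<inter> L" using facetD[OF assms(1,4)] assms by blast
  then have FI: "F face_of (K \<inter> L)"
    using face_of_subset[OF facetD(1)[OF assms(1,4)], of "K \<inter> L"] by blast
  have "K \<inter> L \<noteq> K"
    using interior_Int[OF assms(1-3)] tetrahedron(6)[OF assms(1)] interior_subset by blast
  then have "aff_dim (K \<inter> L) < 3"
    using face_of_aff_dim_lt[OF tetrahedron(1)[OF assms(1)] Int_face[OF assms(1,2)]] tetrahedron(5)[OF assms(1)] by simp
  then have "\<not> aff_dim F < aff_dim (K \<inter> L)" using facetD(4)[OF assms(1,4)] by simp
  then show "K \<inter> L = F"
    using face_of_aff_dim_lt[OF convex_Int[OF tetrahedron(1)[OF assms(1)] tetrahedron(1)[OF assms(2)]] FI] by blast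
  then show "adj K L" using facetD(4)[OF assms(1,4)] by (simp add: adj_def)
qed

text \<open>By conformity \<open>K \<inter> L\<close> is a face of \<open>K\<close>; a face that
  meets the relative interior of \<open>t\<close> contains \<open>t\<close>.\<close>

lemma star_face:
  assumes "K \<in> T" "t face_of K" "x \<in> rel_interior t" "L \<in> star x"
  shows "t \<subseteq> L" "t face_of L"
proof -
  have L: "L \<in> T" "x \<in> L" using assms by (auto simp: star_def)
  have tK: "t \<subseteq> K" using assms face_of_imp_subset by blast
  have "x \<in> K" using assms(3) rel_interior_subset tK by blast
  then have "t \<subseteq> K \<inter> L"
    using subset_of_face_of[OF Int_face[OF assms(1) L(1)] tK] assms(3) L by blast
  then show "t \<subseteq> L" by blast
  have "t face_of K \<inter> L"
    using face_of_subset[OF assms(2) \<open>t \<subseteq> K \<inter> L\<close>] by blast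
  then show "t face_of L"
    using Int_face[OF L(1) assms(1)] face_of_trans by (metis Int_commute)
qed

lemma star_facet:
  assumes "K \<in> T" "F facet_of K" "x \<in> rel_interior F"
  shows "star x = {L \<in> T. F \<subseteq> L}"
  using star_face(1)[OF assms(1) facetD(1)[OF assms(1,2)] assms(3)] assms(3) rel_interior_subset
  by (auto simp: star_def)

section \<open>Local structure at a point and across a facet\<close>

lemma star_ball:
  obtains r where "r > 0" "\<And>K. K \<in> T \<Longrightarrow> K \<inter> ball x r \<noteq> {} \<Longrightarrow> K \<in> star x"
proof (rule finite_closed_cover_local[OF finT tetrahedron(3), of x])
  fix r :: real assume "r > 0" "\<And>K. K \<in> T \<Longrightarrow> K \<inter> ball x r \<noteq> {} \<Longrightarrow> x \<in> K"
  then show thesis by (intro that[of r]) (auto simp: star_def)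
qed

lemma \<Omega>_star_ball:
  assumes "x \<in> \<Omega>"
  obtains r where "r > 0" "\<And>K. K \<in> T \<Longrightarrow> K \<inter> ball x r \<noteq> {} \<Longrightarrow> K \<in> star x"
    "ball x r \<subseteq> \<Omega>" "ball x r \<subseteq> \<Union>(star x)"
proof -
  obtain r where r: "r > 0" "\<And>K. K \<in> T \<Longrightarrow> K \<inter> ball x r \<noteq> {} \<Longrightarrow> K \<in> star x"
    using star_ball by metis
  obtain r' where r': "r' > 0" "ball x r' \<subseteq> \<Omega>" using opn assms open_contains_ball by blast
  show thesis
  proof (rule that[of "min r r'"])
    show "min r r' > 0" using r r' by simp
    show "K \<in> star x" if "K \<in> T" "K \<inter> ball x (min r r') \<noteq> {}" for K
      using that by (intro r(2)) auto
    show sub: "ball x (min r r') \<subseteq> \<Omega>" using r' by auto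
    show "ball x (min r r') \<subseteq> \<Union> (star x)"
    proof
      fix y assume y: "y \<in> ball x (min r r')"
      then have "y \<in> \<Union>T" using UnT sub closure_subset by blast
      then obtain K where "K \<in> T" "y \<in> K" by blast
      moreover have "y \<in> K \<inter> ball x r" using y \<open>y \<in> K\<close> by simp
      ultimately have "K \<in> star x" using r(2)[of K] by blast
      then show "y \<in> \<Union>(star x)" using \<open>y \<in> K\<close> by blast
    qed
  qed
qed

text \<open>The plane supports \<open>K\<close> along \<open>F\<close>. Being three-dimensional,
  \<open>L\<close> has a point off this plane and so fills a half ball on that side.\<close>

lemma facet_sides:
  assumes K: "K \<in> T" and F: "F facet_of K" and z: "z \<in> rel_interior F"
  obtains a b where "a \<noteq> 0" "a \<bullet> z = b" "K \<subseteq> {y. a \<bullet> y \<le> b}"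
    "\<And>L. L \<in> T \<Longrightarrow> F \<subseteq> L \<Longrightarrow> \<exists>r>0. ball z r \<inter> {y. a \<bullet> y \<le> b} \<subseteq> L \<or> ball z r \<inter> {y. a \<bullet> y \<ge> b} \<subseteq> L"
proof -
  obtain a b where ab: "a \<noteq> 0" "K \<subseteq> {x. a \<bullet> x \<le> b}" "F = K \<inter> {x. a \<bullet> x = b}"
    using facet_of_polyhedron[OF simplex_imp_polyhedron[OF simplex3[OF K]] F] by blast
  \<comment> \<open>\<open>F\<close> lies in the plane and has the same dimension 2, so it spans the
    plane.\<close>
  have "affine hull F = affine hull {x. a \<bullet> x = b}"
    using aff_dim_eq_full_gen[of F "{x. a \<bullet> x = b}"] ab(1,3) facetD(4)[OF K F] by simp
  then have aff: "affine hull F = {x. a \<bullet> x = b}" by (simp add: affine_hyperplane hull_same)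
  then have aff': "affine hull F = {x. (- a) \<bullet> x = - b}" by simp
  have az: "a \<bullet> z = b" using z ab(3) rel_interior_subset by blast
  show thesis
  proof (rule that[OF ab(1) az ab(2)])
    fix L assume L: "L \<in> T" "F \<subseteq> L"
    have "\<not> L \<subseteq> {x. a \<bullet> x = b}"
    proof
      assume "L \<subseteq> {x. a \<bullet> x = b}"
      then have "aff_dim L \<le> aff_dim {x. a \<bullet> x = b}" by (rule aff_dim_subset)
      then show False using tetrahedron(5)[OF L(1)] ab(1) by simp
    qed
    then obtain q where q: "q \<in> L" "a \<bullet> q < b \<or> a \<bullet> q > b" by force
    from q(2) show "\<exists>r>0. ball z r \<inter> {y. a \<bullet> y \<le> b} \<subseteq> L \<or> ball z r \<inter> {y. a \<bullet> y \<ge> b} \<subseteq> L"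
    proof
      assume "a \<bullet> q < b"
      then show ?thesis using half_ball_subset[OF tetrahedron(1)[OF L(1)] L(2) z aff q(1)] by metis
    next
      assume "a \<bullet> q > b"
      then have "(- a) \<bullet> q < - b" by simp
      then obtain r where "r > 0" "ball z r \<inter> {y. (- a) \<bullet> y \<le> - b} \<subseteq> L"
        using half_ball_subset[OF tetrahedron(1)[OF L(1)] L(2) z aff' q(1)] by metis
      then show ?thesis by auto
    qed
  qed
qed

lemma half_ball_nonempty:
  fixes a z :: "real^3"
  assumes "a \<noteq> 0" "a \<bullet> z = b" "r > 0"
  shows "ball z r \<inter> {y. a \<bullet> y < b} \<noteq> {}" "ball z r \<inter> {y. a \<bullet> y > b} \<noteq> {}"
proof -
  let ?v = "(r / 2 / norm a) *\<^sub>R a"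
  have n: "norm ?v < r" using assms by simp
  have p: "a \<bullet> ?v > 0" using assms by (simp add: dot_square_norm)
  have "z - ?v \<in> ball z r \<inter> {y. a \<bullet> y < b}" "z + ?v \<in> ball z r \<inter> {y. a \<bullet> y > b}"
    using n p assms(2) by (auto simp: dist_norm inner_diff_right inner_add_right)
  then show "ball z r \<inter> {y. a \<bullet> y < b} \<noteq> {}" "ball z r \<inter> {y. a \<bullet> y > b} \<noteq> {}" by blast+
qed

lemma same_side_eq:
  assumes "K \<in> T" "L \<in> T" "a \<noteq> 0" "a \<bullet> z = b" "r > 0" "s > 0"
    and "ball z r \<inter> {y. a \<bullet> y \<le> b} \<subseteq> K" "ball z s \<inter> {y. a \<bullet> y \<le> b} \<subseteq> L"
  shows "K = L"
proof (rule interior_eqI[OF assms(1,2)])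
  show "ball z (min r s) \<inter> {y. a \<bullet> y < b} \<subseteq> K" "ball z (min r s) \<inter> {y. a \<bullet> y < b} \<subseteq> L"
    using assms(7,8) by auto
  show "open (ball z (min r s) \<inter> {y. a \<bullet> y < b})"
    by (intro open_Int open_ball open_halfspace_lt)
  show "ball z (min r s) \<inter> {y. a \<bullet> y < b} \<noteq> {}"
    using half_ball_nonempty(1)[OF assms(3,4), of "min r s"] assms by simp
qed

text \<open>\<open>K\<close> already fills its own side near \<open>z\<close>, and two tetrahedra on
  one side would share an open set.\<close>

lemma facet_opposite:
  assumes K: "K \<in> T" and F: "F facet_of K" and z: "z \<in> rel_interior F"
  obtains a b r where "a \<noteq> 0" "a \<bullet> z = b" "r > 0" "ball z r \<inter> {y. a \<bullet> y \<le> b} \<subseteq> K"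
    "\<forall>N\<in>T. F \<subseteq> N \<longrightarrow> N \<noteq> K \<longrightarrow> (\<exists>r>0. ball z r \<inter> {y. a \<bullet> y \<ge> b} \<subseteq> N)"
proof -
  obtain a b where ab: "a \<noteq> 0" "a \<bullet> z = b" "K \<subseteq> {y. a \<bullet> y \<le> b}"
    and sd: "\<And>L. L \<in> T \<Longrightarrow> F \<subseteq> L \<Longrightarrow>
      \<exists>r>0. ball z r \<inter> {y. a \<bullet> y \<le> b} \<subseteq> L \<or> ball z r \<inter> {y. a \<bullet> y \<ge> b} \<subseteq> L"
    using facet_sides[OF K F z] by metis
  obtain r where r: "r > 0" "ball z r \<inter> {y. a \<bullet> y \<le> b} \<subseteq> K \<or> ball z r \<inter> {y. a \<bullet> y \<ge> b} \<subseteq> K"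
    using sd[OF K facetD(2)[OF K F]] by blast
  have "\<not> ball z r \<inter> {y. a \<bullet> y \<ge> b} \<subseteq> K"
    using half_ball_nonempty(2)[OF ab(1,2) r(1)] ab(3) by force
  then have rK: "ball z r \<inter> {y. a \<bullet> y \<le> b} \<subseteq> K" using r by blast
  have "\<exists>r>0. ball z r \<inter> {y. a \<bullet> y \<ge> b} \<subseteq> N" if N: "N \<in> T" "F \<subseteq> N" "N \<noteq> K" for N
  proof -
    obtain s where s: "s > 0" "ball z s \<inter> {y. a \<bullet> y \<le> b} \<subseteq> N \<or> ball z s \<inter> {y. a \<bullet> y \<ge> b} \<subseteq> N"
      using sd[OF N(1,2)] by blast
    then show ?thesis using same_side_eq[OF K N(1) ab(1,2) r(1) s(1) rK] N(3) by blast
  qed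
  show thesis
    by (rule that[OF ab(1,2) r(1) rK]) (intro ballI impI, fact)
qed

lemma facet_neighbour_unique:
  assumes K: "K \<in> T" and F: "F facet_of K"
    and L: "L \<in> T" "F \<subseteq> L" "L \<noteq> K" and M: "M \<in> T" "F \<subseteq> M" "M \<noteq> K"
  shows "L = M"
proof -
  obtain z where z: "z \<in> rel_interior F" using facetD(6)[OF K F] by blast
  obtain a b where ab: "a \<noteq> 0" "a \<bullet> z = b"
    and N: "\<forall>N\<in>T. F \<subseteq> N \<longrightarrow> N \<noteq> K \<longrightarrow> (\<exists>r>0. ball z r \<inter> {y. a \<bullet> y \<ge> b} \<subseteq> N)"
    by (rule facet_opposite[OF K F z]) (rule that; assumption)
  obtain r s where r: "r > 0" "ball z r \<inter> {y. a \<bullet> y \<ge> b} \<subseteq> L"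
    and s: "s > 0" "ball z s \<inter> {y. a \<bullet> y \<ge> b} \<subseteq> M"
    using N L M by meson
  \<comment> \<open>The side opposite to \<open>K\<close> takes the form required by
    \<open>same_side_eq\<close> once the normal is reversed.\<close>
  show "L = M"
    by (rule same_side_eq[OF L(1) M(1), of "- a" z "- b" r s]) (use ab r s in auto)
qed

lemma facet_interior_Un:
  assumes K: "K \<in> T" and F: "F facet_of K" and L: "L \<in> T" "F \<subseteq> L" "L \<noteq> K"
    and z: "z \<in> rel_interior F"
  shows "z \<in> interior (K \<union> L)"
proof -
  obtain a b r where ab: "r > 0" "ball z r \<inter> {y. a \<bullet> y \<le> b} \<subseteq> K"
    and N: "\<forall>N\<in>T. F \<subseteq> N \<longrightarrow> N \<noteq> K \<longrightarrow> (\<exists>r>0. ball z r \<inter> {y. a \<bullet> y \<ge> b} \<subseteq> N)"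
    by (rule facet_opposite[OF K F z]) (rule that; assumption)
  obtain s where rs: "r > 0" "s > 0" "ball z r \<inter> {y. a \<bullet> y \<le> b} \<subseteq> K"
    "ball z s \<inter> {y. a \<bullet> y \<ge> b} \<subseteq> L" using ab N L by meson
  have "ball z (min r s) \<subseteq> K \<union> L"
  proof
    fix y assume "y \<in> ball z (min r s)"
    then show "y \<in> K \<union> L" using rs by (cases "a \<bullet> y \<le> b") auto
  qed
  moreover have "z \<in> ball z (min r s)" using rs by simp
  ultimately show ?thesis by (meson interiorI open_ball)
qed

text \<open>The two tetrahedra fill a ball around a relative interior point of their common face, so
  that point is interior to \<open>closure \<Omega>\<close>, and regularity applies. This makes the
  restriction to arcs seen inside \<Omega> harmless.\<close>

lemma adj_meets:
  assumes "K \<in> T" "L \<in> T" "adj K L"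
  shows "K \<inter> L \<inter> \<Omega> \<noteq> {}"
proof -
  note F = adj_facet[OF assms]
  obtain z where z: "z \<in> rel_interior (K \<inter> L)" using facetD(6)[OF assms(1) F(1)] by blast
  have "z \<in> interior (K \<union> L)"
    using facet_interior_Un[OF assms(1) F(1) assms(2) _ _ z] F(3) by auto
  moreover have "K \<union> L \<subseteq> closure \<Omega>" using UnT assms by blast
  ultimately have "z \<in> \<Omega>" using interior_mono regular by blast
  then show ?thesis using z rel_interior_subset by blast
qed

text \<open>Points just beyond the plane of \<open>F\<close> are still covered by the star of
  \<open>z\<close>, but not by \<open>K\<close>.\<close>

lemma facet_neighbour:
  assumes K: "K \<in> T" and F: "F facet_of K" and "rel_interior F \<inter> \<Omega> \<noteq> {}"
  obtains L where "L \<in> T" "L \<noteq> K" "F \<subseteq> L"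
proof -
  obtain z where z: "z \<in> rel_interior F" "z \<in> \<Omega>" using assms by blast
  obtain a b where ab: "a \<noteq> 0" "a \<bullet> z = b" "K \<subseteq> {y. a \<bullet> y \<le> b}"
    using facet_sides[OF K F z(1)] by metis
  obtain r where r: "r > 0" "ball z r \<subseteq> \<Union>(star z)"
    using \<Omega>_star_ball[OF z(2)] by metis
  obtain y where "y \<in> ball z r" "a \<bullet> y > b" using half_ball_nonempty(2)[OF ab(1,2) r(1)] by blast
  then obtain L where L: "L \<in> star z" "y \<in> L" using r by blast
  have "L \<noteq> K" using L(2) \<open>a \<bullet> y > b\<close> ab(3) by auto
  then show thesis using that[of L] star_facet[OF K F z(1)] L(1) by simp
qed

lemma interior_subset_\<Omega>:
  assumes "K \<in> T"
  shows "interior K \<subseteq> \<Omega>"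
proof -
  have "K \<subseteq> closure \<Omega>" using UnT assms by blast
  then show ?thesis using interior_mono regular by blast
qed

text \<open>
  For \<open>w \<in> t\<close> beyond \<open>y\<close> on the ray from \<open>x\<close>, the homothety with centre \<open>w\<close> that takes \<open>x\<close> to \<open>y\<close>
  maps every tetrahedron of the star of \<open>x\<close> into itself, and a ball around \<open>x\<close> to one around \<open>y\<close>.
\<close>
lemma rel_interior_subset_\<Omega>:
  assumes K: "K \<in> T" and t: "t face_of K" and x: "x \<in> rel_interior t" "x \<in> \<Omega>"
  shows "rel_interior t \<subseteq> \<Omega>"
proof
  fix y assume y: "y \<in> rel_interior t"
  have cv: "convex t" using t face_of_imp_convex by blast
  show "y \<in> \<Omega>"
  proof (cases "x = y")
    case False
    obtain r where r: "r > 0" "ball x r \<subseteq> \<Union>(star x)" using \<Omega>_star_ball[OF x(2)] by metis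
    have "x \<in> affine hull t" using x(1) rel_interior_subset by (blast intro: hull_inc)
    then obtain e where e: "e > 1" "(1 - e) *\<^sub>R x + e *\<^sub>R y \<in> t"
      using convex_rel_interior_if[OF cv y] by blast
    define w where "w = (1 - e) *\<^sub>R x + e *\<^sub>R y"
    \<comment> \<open>Solving the definition of \<open>w\<close> for \<open>y\<close> gives
      \<open>y = l *\<^sub>R x + (1 - l) *\<^sub>R w\<close>.\<close>
    define l where "l = 1 - 1 / e"
    have l: "0 < l" "l < 1" using e by (auto simp: l_def)
    have yw: "y = l *\<^sub>R x + (1 - l) *\<^sub>R w"
      using e by (simp add: w_def l_def algebra_simps)
    have "ball y (l * r) \<subseteq> \<Union>T"
    proof
      fix u assume u: "u \<in> ball y (l * r)"
      \<comment> \<open>\<open>v\<close> is the preimage of \<open>u\<close> under the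
        homothety.\<close>
      define v where "v = x + (1 / l) *\<^sub>R (u - y)"
      have "norm (u - y) < l * r" using u by (simp add: dist_norm norm_minus_commute)
      moreover have "dist x v = norm (u - y) / l" using l by (simp add: v_def dist_norm)
      ultimately have "v \<in> ball x r" using l by (simp add: divide_less_eq mult.commute)
      then obtain L where L: "L \<in> star x" "v \<in> L" using r by blast
      then have "w \<in> L" using star_face(1)[OF K t x(1)] e w_def by blast
      moreover have LT: "L \<in> T" using L by (simp add: star_def)
      ultimately have "l *\<^sub>R v + (1 - l) *\<^sub>R w \<in> L"
        using l L by (intro convexD[OF tetrahedron(1)]) auto
      moreover have "l *\<^sub>R v + (1 - l) *\<^sub>R w = u"
        using l yw by (simp add: v_def algebra_simps)
      ultimately show "u \<in> \<Union>T" using LT by auto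
    qed
    moreover have "y \<in> ball y (l * r)" using l r by simp
    ultimately have "y \<in> interior (\<Union>T)" by (meson interiorI open_ball)
    then show ?thesis using UnT regular by simp
  qed (use x in simp)
qed

section \<open>Adjacency inside the star of a point\<close>

lemma finite_edges: "finite (\<Union>K\<in>T. {e. e face_of K \<and> aff_dim e \<le> 1})"
proof (intro finite_UN_I finT)
  fix K assume "K \<in> T"
  then have "finite {e. e face_of K}" using finite_polytope_faces tetrahedron(4) by blast
  then show "finite {e. e face_of K \<and> aff_dim e \<le> 1}" by (rule rev_finite_subset) auto
qed

text \<open>\<open>K \<inter> L\<close> is a proper common face through \<open>z\<close>, and
  dimensions up to 1 are excluded by the choice of \<open>z\<close>.\<close>

lemma star_adj:
  assumes "x \<in> \<Omega>" "K \<in> star x" "L \<in> star x" "K \<noteq> L" 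
    and z: "z \<in> K \<inter> L" "\<And>e M. M \<in> T \<Longrightarrow> e face_of M \<Longrightarrow> aff_dim e \<le> 1 \<Longrightarrow> z \<notin> e"
  shows "adj K L"
proof -
  have KL: "K \<in> T" "L \<in> T" using assms by (auto simp: star_def)
  have "\<not> aff_dim (K \<inter> L) \<le> 1" using z Int_face[OF KL] KL by blast
  moreover have "aff_dim (K \<inter> L) < 3"
  proof -
    have "K \<inter> L \<noteq> K"
      using interior_Int[OF KL assms(4)] tetrahedron(6)[OF KL(1)] interior_subset by blast
    then show ?thesis
      using face_of_aff_dim_lt[OF tetrahedron(1)[OF KL(1)] Int_face[OF KL]] tetrahedron(5)[OF KL(1)] by simp
  qed
  ultimately show ?thesis by (simp add: adj_def)
qed

text \<open>The unions of \<open>A\<close> and of its complement in the star are closed and cover a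
  segment that avoids all edges. By connectedness they meet on it, and there a member of
  \<open>A\<close> is adjacent to one outside.\<close>

lemma star_connected:
  assumes "x \<in> \<Omega>"
  shows "graph_connected adj (star x)"
  unfolding graph_connected_def
proof (intro allI impI)
  fix A assume A: "A \<subseteq> star x" "A \<noteq> {}" and closed_A: "\<forall>K\<in>A. \<forall>L\<in>star x. adj K L \<longrightarrow> L \<in> A"
  show "A = star x"
  proof (rule ccontr)
    assume "A \<noteq> star x"
    then obtain K L where K: "K \<in> A" and L: "L \<in> star x - A" using A by blast
    have KL: "K \<in> T" "x \<in> K" "L \<in> T" "x \<in> L" using K L A by (auto simp: star_def)
    obtain r where r: "r > 0" "ball x r \<subseteq> \<Union>(star x)" using \<Omega>_star_ball[OF assms] by metis
    have ne: "interior M \<inter> ball x r \<noteq> {}" if "M \<in> T" "x \<in> M" for M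
    proof -
      have "x \<in> closure (interior M)" using tetrahedron(7) that by simp
      then show ?thesis using r(1) by (metis centre_in_ball closure_iff_nhds_not_empty Int_commute open_ball order_refl)
    qed
    let ?E = "\<Union>K\<in>T. {e. e face_of K \<and> aff_dim e \<le> 1}"
    obtain p where p: "p \<in> interior K" "p \<in> ball x r" using ne KL by blast
    have pE: "p \<notin> \<Union>?E"
    proof
      assume "p \<in> \<Union>?E"
      then obtain M e where e: "M \<in> T" "e face_of M" "aff_dim e \<le> 1" "p \<in> e" by blast
      then have "p \<in> M" using face_of_imp_subset by blast
      then have "M = K" using interior_Int[OF KL(1) e(1)] p by blast
      moreover have "e \<noteq> K" using e tetrahedron(5)[OF KL(1)] by auto
      ultimately show False using face_of_disjoint_interior[of e K] e p by blast
    qed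
    obtain q where q: "q \<in> interior L \<inter> ball x r" "closed_segment p q \<inter> \<Union>?E = {}"
    proof (rule exists_segment_avoiding_lines[of ?E "interior L \<inter> ball x r" p])
      show "finite ?E" by (rule finite_edges)
      show "interior L \<inter> ball x r \<noteq> {}" by (rule ne[OF KL(3,4)])
      show "p \<notin> \<Union>?E" by (rule pE)
    qed auto
    have seg: "closed_segment p q \<subseteq> ball x r"
      using p q by (intro closed_segment_subset) auto
    have finS: "finite (star x)" using finT by (simp add: star_def)
    have cl: "closed (\<Union>A)" "closed (\<Union>(star x - A))"
      using A finS tetrahedron(3) by (auto intro!: closed_Union intro: finite_subset simp: star_def)
    have "\<Union>A \<inter> \<Union>(star x - A) \<inter> closed_segment p q \<noteq> {}"
    proof
      assume "\<Union>A \<inter> \<Union>(star x - A) \<inter> closed_segment p q = {}"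
      moreover have "closed_segment p q \<subseteq> \<Union>A \<union> \<Union>(star x - A)" using seg r(2) by blast
      moreover have "p \<in> \<Union>A" using p K interior_subset by blast
      moreover have "q \<in> \<Union>(star x - A)" using q L interior_subset by blast
      ultimately show False
        using connected_closedD[OF connected_segment(1)[of p q] _ _ cl] ends_in_segment[of p q] by blast
    qed
    then obtain z M N where z: "z \<in> closed_segment p q" "M \<in> A" "z \<in> M" "N \<in> star x - A" "z \<in> N" by blast
    have "adj M N"
    proof (rule star_adj[OF assms])
      show "z \<notin> e" if "M' \<in> T" "e face_of M'" "aff_dim e \<le> 1" for e M' using q(2) z(1) that by blast
    qed (use z A in auto)
    then show False using closed_A z by blast
  qed
qed


lemma facet_meets_\<Omega>:
  assumes "K \<in> T" "F facet_of K" "x \<in> F" "x \<in> \<Omega>"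
  shows "rel_interior F \<inter> \<Omega> \<noteq> {}"
proof -
  have "x \<in> closure (rel_interior F)"
    using convex_closure_rel_interior[OF facetD(5)[OF assms(1,2)]] assms(3) closure_subset by blast
  then show ?thesis using opn assms(4) by (metis Int_commute closure_iff_nhds_not_empty order_refl)
qed

text \<open>Neighbours \<open>L\<close> of \<open>K\<close> correspond to the two facets of
  \<open>K\<close> through \<open>e\<close> by \<open>K \<inter> L\<close>. Each such facet has a
  second tetrahedron because it contains the point \<open>x\<close> of \<Omega>.\<close>

lemma edge_star_degree:
  assumes K0: "K0 \<in> T" and e: "e face_of K0" "aff_dim e = 1" and x: "x \<in> rel_interior e" "x \<in> \<Omega>"
    and K: "K \<in> star x"
  shows "card {L \<in> star x. adj K L} = 2"
proof -
  have KT: "K \<in> T" using K by (simp add: star_def)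
  have eK: "e face_of K" using star_face(2)[OF K0 e(1) x(1) K] .
  have xe: "x \<in> e" using x rel_interior_subset by blast
  have "bij_betw (\<lambda>L. K \<inter> L) {L \<in> star x. adj K L} {F. F facet_of K \<and> e \<subseteq> F}"
  proof (rule bij_betw_imageI)
    show "inj_on (\<lambda>L. K \<inter> L) {L \<in> star x. adj K L}"
    proof (rule inj_onI)
      fix L M assume LM: "L \<in> {L \<in> star x. adj K L}" "M \<in> {L \<in> star x. adj K L}" "K \<inter> L = K \<inter> M"
      then have "L \<in> T" "M \<in> T" "adj K L" "adj K M" by (auto simp: star_def)
      then show "L = M"
        using facet_neighbour_unique[OF KT adj_facet(1)[OF KT], of L L M] adj_facet(3)[OF KT] LM(3) by blast
    qed
    show "(\<lambda>L. K \<inter> L) ` {L \<in> star x. adj K L} = {F. F facet_of K \<and> e \<subseteq> F}"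
    proof (intro equalityI subsetI)
      fix F assume "F \<in> (\<lambda>L. K \<inter> L) ` {L \<in> star x. adj K L}"
      then obtain L where L: "L \<in> star x" "adj K L" "F = K \<inter> L" by blast
      moreover have "L \<in> T" using L(1) by (simp add: star_def)
      ultimately show "F \<in> {F. F facet_of K \<and> e \<subseteq> F}"
        using adj_facet(1)[OF KT _ L(2)] star_face(1)[OF K0 e(1) x(1)] K by blast
    next
      fix F assume "F \<in> {F. F facet_of K \<and> e \<subseteq> F}"
      then have F: "F facet_of K" "e \<subseteq> F" by auto
      obtain L where L: "L \<in> T" "L \<noteq> K" "F \<subseteq> L"
        using facet_neighbour[OF KT F(1) facet_meets_\<Omega>[OF KT F(1)]] F(2) xe x(2) by blast
      then have "L \<in> star x" using F(2) xe by (auto simp: star_def)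
      then show "F \<in> (\<lambda>L. K \<inter> L) ` {L \<in> star x. adj K L}"
        using facet_Int_eq[OF KT L(1) L(2)[symmetric] F(1) L(3)] by blast
    qed
  qed
  then have "card {L \<in> star x. adj K L} = card {F. F facet_of K \<and> e \<subseteq> F}" by (rule bij_betw_same_card)
  then show ?thesis
    using simplex_facets_containing_edge[OF simplex3[OF KT] eK e(2)] by simp
qed

lemma edge_star:
  assumes "K \<in> T" "e face_of K" "x \<in> rel_interior e"
  shows "star x = {L \<in> T. e \<subseteq> L}"
  using star_face(1)[OF assms] assms(3) rel_interior_subset by (auto simp: star_def)

section \<open>Two-colourings of single stars\<close>

lemma finite_star: "finite (star x)"
  using finT by (simp add: star_def)

definition vertices :: "(real^3) set" where "vertices = {x. \<exists>K\<in>T. x extreme_point_of K}"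

lemma finite_vertices: "finite vertices"
proof -
  have "finite (\<Union>K\<in>T. {v. v extreme_point_of K})"
    using finT finite_polyhedron_extreme_points simplex_imp_polyhedron simplex3 by blast
  then show ?thesis by (rule rev_finite_subset) (auto simp: vertices_def)
qed

lemma zero_dim_face_vertex:
  assumes "K \<in> T" "F face_of K" "aff_dim F = 0" "x \<in> F"
  shows "x \<in> vertices"
proof -
  obtain a where "F = {a}" using assms(3) aff_dim_eq_0[of F] by blast
  then have "F = {x}" using assms(4) by simp
  then have "x extreme_point_of K" using assms(2) by (simp add: face_of_singleton)
  then show ?thesis using assms(1) by (auto simp: vertices_def)
qed

lemma rel_interior_or_facet:
  assumes "K \<in> T" "F face_of K" "x \<in> F" "x \<notin> rel_interior F"
  obtains G where "G face_of K" "aff_dim G = aff_dim F - 1" "x \<in> G"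
proof -
  have "polyhedron F"
    using face_of_polyhedron_polyhedron[OF simplex_imp_polyhedron[OF simplex3[OF assms(1)]] assms(2)] .
  then have "x \<in> \<Union>{G. G facet_of F}" using rel_boundary_of_polyhedron assms(3,4) by blast
  then obtain G where "G facet_of F" "x \<in> G" by blast
  then show thesis using that face_of_trans[OF _ assms(2)] by (auto simp: facet_of_def)
qed

text \<open>Closed edges are counted by containment in tetrahedra, which is how stars are described;
  \<open>edge_condition_iff\<close> returns to open edges in frontiers.\<close>

definition edge_condition :: bool where
  "edge_condition \<longleftrightarrow>
    (\<forall>K\<in>T. \<forall>e. e edge_of K \<longrightarrow> rel_interior e \<subseteq> \<Omega> \<longrightarrow> even (card {L \<in> T. e \<subseteq> L}))"

lemma star_2col_nonvertex:
  assumes x: "x \<in> \<Omega>" "x \<notin> vertices" and edge_condition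
  shows "\<exists>c. proper_2col adj (star x) c"
proof (cases "\<exists>K\<in>T. \<exists>e. e face_of K \<and> aff_dim e \<le> 1 \<and> x \<in> e")
  case True
  then obtain K e where K: "K \<in> T" and e: "e face_of K" "aff_dim e \<le> 1" "x \<in> e" by blast
  have "aff_dim e \<noteq> 0" using zero_dim_face_vertex[OF K e(1) _ e(3)] x(2) by blast
  moreover have "aff_dim e \<noteq> -1" using e(3) aff_dim_empty by blast
  moreover have "aff_dim e \<ge> -1" by (rule aff_dim_geq)
  ultimately have e1: "aff_dim e = 1" using e(2) by linarith
  have xe: "x \<in> rel_interior e"
  proof (rule ccontr)
    assume "x \<notin> rel_interior e"
    then obtain G where "G face_of K" "aff_dim G = aff_dim e - 1" "x \<in> G"
      using rel_interior_or_facet[OF K e(1,3)] by metis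
    then show False using zero_dim_face_vertex[OF K] e1 x(2) by simp
  qed
  have "rel_interior e \<subseteq> \<Omega>" by (rule rel_interior_subset_\<Omega>[OF K e(1) xe x(1)])
  then have "even (card {L \<in> T. e \<subseteq> L})"
    using \<open>edge_condition\<close> K e(1) e1 by (simp add: edge_condition_def edge_of_def)
  then have "even (card (star x))" by (simp add: edge_star[OF K e(1) xe])
  then show ?thesis
  proof (intro two_regular_even_imp_2col)
    show "card {L \<in> star x. adj M L} = 2" if "M \<in> star x" for M
      by (rule edge_star_degree[OF K e(1) e1 xe x(1) that])
    show "\<not> adj M M" if "M \<in> star x" for M using that not_adj_self by (simp add: star_def)
  qed (use finite_star adj_sym star_connected x(1) in auto)
next
  case False
  obtain r where "r > 0" "ball x r \<subseteq> \<Union>(star x)" using \<Omega>_star_ball[OF x(1)] by metis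
  then obtain K where K: "K \<in> star x" by (meson UnionE centre_in_ball subsetD)
  have KT: "K \<in> T" using K by (simp add: star_def)
  \<comment> \<open>Here \<open>x\<close> lies on no edge, so \<open>x\<close> itself is the common
    point required by \<open>star_adj\<close>.\<close>
  have all_adj: "adj L M" if "L \<in> star x" "M \<in> star x" "L \<noteq> M" for L M
    by (rule star_adj[OF x(1) that, of x]) (use that False in \<open>auto simp: star_def\<close>)
  \<comment> \<open>\<open>x\<close> is in the relative interior of the facet
    \<open>K \<inter> L\<close>, so a third tetrahedron at \<open>x\<close> would contain this facet
    too.\<close>
  have uniq: "L = M" if L: "L \<in> star x" "L \<noteq> K" and M: "M \<in> star x" "M \<noteq> K" for L M
  proof -
    have LM: "L \<in> T" "M \<in> T" using L M by (auto simp: star_def)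
    have F: "K \<inter> L facet_of K" using adj_facet(1)[OF KT LM(1)] all_adj[OF K L(1)] L(2) by blast
    note F' = facetD[OF KT F]
    have xF: "x \<in> K \<inter> L" using K L by (simp add: star_def)
    have "x \<in> rel_interior (K \<inter> L)"
    proof (rule ccontr)
      assume "x \<notin> rel_interior (K \<inter> L)"
      then obtain G where "G face_of K" "aff_dim G = aff_dim (K \<inter> L) - 1" "x \<in> G"
        using rel_interior_or_facet[OF KT F'(1) xF] by metis
      then show False using False KT F'(4) by auto
    qed
    then have "K \<inter> L \<subseteq> M" by (rule star_face(1)[OF KT F'(1) _ M(1)])
    then show ?thesis using facet_neighbour_unique[OF KT F LM(1) _ L(2) LM(2) _ M(2)] by blast
  qed
  have "proper_2col adj (star x) (\<lambda>L. if L = K then 1 else - 1)"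
    unfolding proper_2col_def
  proof (intro conjI ballI impI)
    fix L M assume LM: "L \<in> star x" "M \<in> star x" "adj L M"
    then have "L \<noteq> M" using not_adj_self by (auto simp: star_def)
    then have "L = K \<longleftrightarrow> M \<noteq> K" using uniq LM by blast
    then show "(if M = K then 1 else - 1) = - (if L = K then 1 else - 1 :: real)"
      by simp
  qed auto
  then show ?thesis by blast
qed

lemma star_2col:
  assumes x: "x \<in> \<Omega>" and edge_condition
  shows "\<exists>c. proper_2col adj (star x) c"
proof (cases "x \<in> vertices")
  case True
  then obtain K0 where K0: "K0 \<in> T" "{x} face_of K0" by (auto simp: vertices_def face_of_singleton)
  obtain r where r: "r > 0" "\<And>K. K \<in> T \<Longrightarrow> K \<inter> ball x r \<noteq> {} \<Longrightarrow> K \<in> star x" "ball x r \<subseteq> \<Omega>"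
    using \<Omega>_star_ball[OF x] by metis
  have "open (- (vertices - {x}))" using finite_vertices by (intro open_Compl finite_imp_closed) auto
  then obtain r' where r': "r' > 0" "ball x r' \<subseteq> - (vertices - {x})"
    by (meson ComplI Diff_iff open_contains_ball singletonI)
  \<comment> \<open>\<open>r\<close> keeps the ball inside \<Omega> and off tetrahedra without
    \<open>x\<close>; \<open>r'\<close> excludes all other vertices, so that
    \<open>star_2col_nonvertex\<close> covers the punctured ball.\<close>
  define \<rho> where "\<rho> = min r r'"
  define S where "S = ball x \<rho> - {x}"
  have \<rho>: "\<rho> > 0" "ball x \<rho> \<subseteq> \<Omega>" "ball x \<rho> \<inter> vertices \<subseteq> {x}"
    using r r' by (auto simp: \<rho>_def)
  have S\<Omega>: "S \<subseteq> \<Omega>" "S \<inter> vertices = {}" using \<rho> by (auto simp: S_def)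
  have starx: "K \<in> star x" if "K \<in> T" "K \<inter> S \<noteq> {}" for K
  proof (rule r(2)[OF that(1)])
    show "K \<inter> ball x r \<noteq> {}" using that(2) by (auto simp: S_def \<rho>_def)
  qed
  have sc: "simply_connected S"
    unfolding S_def using \<rho>(1) by (intro simply_connected_punctured_convex) (auto simp: aff_dim_open)
  have "\<exists>c. proper_2col (\<lambda>K L. adj K L \<and> K \<inter> L \<inter> S \<noteq> {}) T c"
  proof (rule local_2col_imp_global[OF sc _ finT])
    show "closed K" if "K \<in> T" for K using tetrahedron(3)[OF that] .
    show "open S" by (simp add: S_def open_Diff)
    show "S \<subseteq> \<Union>T" using S\<Omega> UnT closure_subset by blast
    show "graph_connected adj {K \<in> T. y \<in> K}" if "y \<in> S" for y
      using star_connected[of y] that S\<Omega> by (auto simp: star_def)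
    show "\<exists>c. proper_2col adj {K \<in> T. y \<in> K} c" if "y \<in> S" for y
      using star_2col_nonvertex[of y] that S\<Omega> \<open>edge_condition\<close> by (auto simp: star_def)
    show "connected (K \<inter> S)" if K: "K \<in> T" for K
    proof (cases "K \<inter> S = {}")
      case False
      then have "K \<in> star x" using starx K by blast
      \<comment> \<open>\<open>x\<close> is a vertex of every tetrahedron that contains it, and a
        convex set stays convex when an extreme point is deleted.\<close>
      then have "{x} face_of K" using star_face(2)[OF K0] by simp
      then have "convex (K - {x})"
        using extreme_point_of_stillconvex[OF tetrahedron(1)[OF K]] by (simp add: face_of_singleton)
      then have "convex ((K - {x}) \<inter> ball x \<rho>)" by (simp add: convex_Int)
      moreover have "(K - {x}) \<inter> ball x \<rho> = K \<inter> S" by (auto simp: S_def)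
      ultimately show ?thesis using convex_connected by metis
    qed simp
  qed
  then obtain c where c: "proper_2col (\<lambda>K L. adj K L \<and> K \<inter> L \<inter> S \<noteq> {}) T c" by blast
  \<comment> \<open>The colouring \<open>c\<close> only respects adjacencies visible in
    \<open>S\<close>. A common face has a point \<open>y\<close> besides \<open>x\<close>, which is
    pulled towards \<open>x\<close> into the ball.\<close>
  have "K \<inter> L \<inter> S \<noteq> {}" if "K \<in> star x" "L \<in> star x" "adj K L" for K L
  proof -
    have KL: "K \<in> T" "x \<in> K" "L \<in> T" "x \<in> L" using that by (auto simp: star_def)
    have "K \<inter> L \<noteq> {x}" using that(3) by (auto simp: adj_def)
    then obtain y where y: "y \<in> K" "y \<in> L" "y \<noteq> x" using KL by blast
    \<comment> \<open>The bound \<open>1/2\<close> keeps \<open>t\<close> below 1; the other one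
      puts \<open>u\<close> within \<open>\<rho> / 2\<close> of \<open>x\<close>.\<close>
    define t where "t = min (1/2) (\<rho> / 2 / dist y x)"
    have t: "0 < t" "t < 1" using y \<rho> by (auto simp: t_def)
    define u where "u = (1 - t) *\<^sub>R x + t *\<^sub>R y"
    have "u \<in> K" "u \<in> L"
      unfolding u_def using t y KL by (auto intro!: convexD tetrahedron(1))
    moreover have "u - x = t *\<^sub>R (y - x)" by (simp add: u_def algebra_simps)
    then have "dist u x = t * dist y x" "u \<noteq> x" using t y by (auto simp: dist_norm)
    moreover have "t * dist y x \<le> \<rho> / 2 / dist y x * dist y x"
      by (intro mult_right_mono) (auto simp: t_def)
    ultimately show ?thesis using y \<rho>(1) by (auto simp: S_def dist_commute)
  qed
  then have "proper_2col adj (star x) c"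
    using c by (auto simp: proper_2col_def star_def)
  then show ?thesis by blast
qed (use star_2col_nonvertex assms in blast)

section \<open>From stars to the whole mesh\<close>

lemma connected_Int_\<Omega>:
  assumes "K \<in> T"
  shows "connected (K \<inter> \<Omega>)"
proof (rule connected_intermediate_closure)
  show "connected (interior K)" using tetrahedron(1)[OF assms] by (simp add: convex_connected)
  show "interior K \<subseteq> K \<inter> \<Omega>" using interior_subset interior_subset_\<Omega>[OF assms] by blast
  show "K \<inter> \<Omega> \<subseteq> closure (interior K)" using tetrahedron(7)[OF assms] by blast
qed

lemma mesh_2col_imp_edge_condition:
  assumes c: "proper_2col adj T c"
  shows edge_condition
  unfolding edge_condition_def
proof (intro ballI allI impI)
  fix K e assume K: "K \<in> T" and "e edge_of K" and e\<Omega>: "rel_interior e \<subseteq> \<Omega>"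
  then have e: "e face_of K" "aff_dim e = 1" by (auto simp: edge_of_def)
  then have "e \<noteq> {}" by auto
  then obtain x where x: "x \<in> rel_interior e"
    using rel_interior_eq_empty[OF face_of_imp_convex[OF e(1)]] by blast
  have "even (card (star x))"
  proof (rule two_regular_2col_imp_even_card[where R = adj and c = c])
    show "card {L \<in> star x. adj M L} = 2" if "M \<in> star x" for M
      using edge_star_degree[OF K e x _ that] x e\<Omega> by blast
    show "proper_2col adj (star x) c" by (rule proper_2col_subset[OF c]) (auto simp: star_def)
  qed (use finite_star adj_sym in auto)
  then show "even (card {L \<in> T. e \<subseteq> L})" by (simp add: edge_star[OF K e(1) x])
qed

lemma edge_condition_imp_mesh_2col:
  assumes "simply_connected \<Omega>" edge_condition
  shows "\<exists>c. proper_2col adj T c"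
proof -
  have "\<exists>c. proper_2col (\<lambda>K L. adj K L \<and> K \<inter> L \<inter> \<Omega> \<noteq> {}) T c"
  proof (rule local_2col_imp_global[OF assms(1) opn finT])
    show "closed K" if "K \<in> T" for K using tetrahedron(3)[OF that] .
    show "\<Omega> \<subseteq> \<Union>T" using UnT closure_subset by blast
    show "graph_connected adj {K \<in> T. y \<in> K}" if "y \<in> \<Omega>" for y
      using star_connected[OF that] by (simp add: star_def)
    show "\<exists>c. proper_2col adj {K \<in> T. y \<in> K} c" if "y \<in> \<Omega>" for y
      using star_2col[OF that assms(2)] by (simp add: star_def)
    show "connected (K \<inter> \<Omega>)" if "K \<in> T" for K by (rule connected_Int_\<Omega>[OF that])
  qed
  then obtain c where "proper_2col (\<lambda>K L. adj K L \<and> K \<inter> L \<inter> \<Omega> \<noteq> {}) T c" by blast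
  then have "proper_2col adj T c" using adj_meets by (auto simp: proper_2col_def)
  then show ?thesis by blast
qed

section \<open>Open edges, frontiers and the mesh graph\<close>

lemma edge_in_frontier_iff:
  assumes "K \<in> T" "e edge_of K" "L \<in> T"
  shows "rel_interior e \<subseteq> frontier L \<longleftrightarrow> e \<subseteq> L"
proof -
  have e: "e face_of K" "aff_dim e = 1" using assms(2) by (auto simp: edge_of_def)
  then have "e \<noteq> {}" by auto
  then obtain x where x: "x \<in> rel_interior e"
    using rel_interior_eq_empty[OF face_of_imp_convex[OF e(1)]] by blast
  have fr: "frontier L = L - interior L" using tetrahedron(3)[OF assms(3)] by (simp add: frontier_def)
  show ?thesis
  proof
    assume "rel_interior e \<subseteq> frontier L"
    then have "L \<in> star x" using x fr assms(3) by (auto simp: star_def)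
    then show "e \<subseteq> L" by (rule star_face(1)[OF assms(1) e(1) x])
  next
    \<comment> \<open>An edge contained in \<open>L\<close> is a proper face of \<open>L\<close> by
      conformity, hence avoids its interior.\<close>
    assume eL: "e \<subseteq> L"
    then have "L \<in> star x" using x assms(3) rel_interior_subset by (auto simp: star_def)
    then have "e face_of L" by (rule star_face(2)[OF assms(1) e(1) x])
    moreover have "e \<noteq> L" using e(2) tetrahedron(5)[OF assms(3)] by auto
    ultimately have "e \<inter> interior L = {}" by (rule face_of_disjoint_interior)
    then show "rel_interior e \<subseteq> frontier L" using eL fr rel_interior_subset by blast
  qed
qed

lemma edge_condition_iff:
  "edge_condition \<longleftrightarrow> (\<forall>\<sigma>\<in>interior_mesh_edges T \<Omega>. even (card {K \<in> T. \<sigma> \<subseteq> frontier K}))"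
proof -
  have eq: "{L \<in> T. rel_interior e \<subseteq> frontier L} = {L \<in> T. e \<subseteq> L}" if "K \<in> T" "e edge_of K" for K e
    using edge_in_frontier_iff[OF that] by blast
  have "(\<forall>\<sigma>\<in>interior_mesh_edges T \<Omega>. even (card {K \<in> T. \<sigma> \<subseteq> frontier K})) \<longleftrightarrow>
    (\<forall>K\<in>T. \<forall>e. e edge_of K \<longrightarrow> rel_interior e \<subseteq> \<Omega> \<longrightarrow>
      even (card {L \<in> T. rel_interior e \<subseteq> frontier L}))"
    unfolding interior_mesh_edges_def mesh_edges_def interior_open[OF opn] by blast
  then show ?thesis unfolding edge_condition_def using eq by simp
qed

lemma mesh_graph_arc_iff:
  assumes "K \<in> T" "L \<in> T"
  shows "(K, L) \<in> parcs (mesh_graph T) \<longleftrightarrow> adj K L"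
proof
  assume "(K, L) \<in> parcs (mesh_graph T)"
  then obtain F where F: "K \<noteq> L" "F facet_of K" "F facet_of L" by (auto simp: mesh_graph_def)
  then show "adj K L"
    using facet_Int_eq(2)[OF assms F(1,2)] facetD(2)[OF assms(2) F(3)] by blast
next
  assume "adj K L"
  then show "(K, L) \<in> parcs (mesh_graph T)"
    using adj_facet[OF assms] assms unfolding mesh_graph_def by auto
qed

lemma bipartite_iff_2col: "bipartite_graph (mesh_graph T) \<longleftrightarrow> (\<exists>c. proper_2col adj T c)"
proof
  assume "bipartite_graph (mesh_graph T)"
  then obtain U V where UV: "T = U \<union> V" "U \<inter> V = {}" "parcs (mesh_graph T) \<subseteq> U \<times> V \<union> V \<times> U"
    by (auto simp: bipartite_graph_def mesh_graph_def)
  have "proper_2col adj T (\<lambda>K. if K \<in> U then 1 else - 1)"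
    unfolding proper_2col_def
  proof (intro conjI ballI impI)
    fix K L assume KL: "K \<in> T" "L \<in> T" "adj K L"
    then have "(K, L) \<in> U \<times> V \<union> V \<times> U" using mesh_graph_arc_iff UV(3) by blast
    then have "L \<in> U \<longleftrightarrow> K \<notin> U" using UV(2) by blast
    then show "(if L \<in> U then 1 else - 1) = - (if K \<in> U then 1 else - 1 :: real)" by simp
  qed auto
  then show "\<exists>c. proper_2col adj T c" by blast
next
  assume "\<exists>c. proper_2col adj T c"
  then obtain c where c: "proper_2col adj T c" by blast
  have c1: "c K = 1 \<or> c K = - 1" if "K \<in> T" for K
  proof -
    have "\<bar>c K\<bar> = 1" using c that by (simp add: proper_2col_def)
    then show ?thesis by linarith
  qed
  define U where "U = {K \<in> T. c K = 1}"
  define V where "V = {K \<in> T. c K = - 1}"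
  have "parcs (mesh_graph T) \<subseteq> U \<times> V \<union> V \<times> U"
  proof
    fix z assume z: "z \<in> parcs (mesh_graph T)"
    then obtain K L where KL: "z = (K, L)" "K \<in> T" "L \<in> T" by (auto simp: mesh_graph_def)
    then have "c L = - c K" using z c mesh_graph_arc_iff by (auto simp: proper_2col_def)
    then show "z \<in> U \<times> V \<union> V \<times> U" using KL c1[of K] by (auto simp: U_def V_def)
  qed
  moreover have "T = U \<union> V" using c1 by (auto simp: U_def V_def)
  moreover have "U \<inter> V = {}" by (auto simp: U_def V_def)
  moreover have "pverts (mesh_graph T) = T" by (simp add: mesh_graph_def)
  ultimately show "bipartite_graph (mesh_graph T)" unfolding bipartite_graph_def by blast
qed

end

theorem theorem3p17:
  fixes \<Omega> :: "(real^3) set" and \<T> :: "(real^3) set set"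
  assumes "polyhedral_domain \<Omega>"
    and "simply_connected \<Omega>"
    and "tetrahedral_mesh \<T> \<Omega>"
  shows "bipartite_graph (mesh_graph \<T>) \<longleftrightarrow>
    (\<forall>\<sigma>\<in>interior_mesh_edges \<T> \<Omega>. even (card {K \<in> \<T>. \<sigma> \<subseteq> frontier K}))"
proof -
  interpret mesh \<T> \<Omega>
    by unfold_locales
      (use assms(1,3) in \<open>auto simp: polyhedral_domain_def tetrahedral_mesh_def triangulation_def\<close>)
  show ?thesis
    using bipartite_iff_2col edge_condition_iff mesh_2col_imp_edge_condition
      edge_condition_imp_mesh_2col[OF assms(2)] by blast
qed

end
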